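(* Let $(X,\mu)$ be a computable probability space, $n\ge 1$, and $A\subseteq\mathbb N$. If $x\in X$ is weakly $\Pi^0_n$-generic relative to $A$, then for any $\Pi^0_n(A)$ set $P\ni x$ with $\mu(P)>0$ and any computable ergodic measure-preserving transformation $T:\subseteq X\to X$ with $x\in\operatorname{dom}T$, we have $T^k(x)\in P$ for some $k>0$.
   Context: Uniformity: a sequence of objects has a property (whose definition involves an index in $\mathbb N$) uniformly if a computable function produces suitable indices. $A^{(m)}$ denotes the $m$-th Turing jump of $A$. A computable metric space is a triple $(X,d,S)$ where $(X,d)$ is a complete separable metric space, $S=(s_i)_i$ is a dense sequence in $X$, and $d(s_i,s_j)$ is a computable real number uniformly in $i,j$. With $(q_j)_j$ a fixed enumeration of the positive rationals and $\langle\cdot,\cdot\rangle$ the standard pairing function, the ideal balls are $B_{\langle i,j\rangle}=\{x\in X: d(x,s_i)<q_j\}$. For an oracle $A\subseteq\mathbb N$: a set $U\subseteq X$ is $\Sigma^0_1(A)$ if $U=\bigcup_{i\in W}B_i$ for some $A$-c.e. $W\subseteq\mathbb N$ (its index is an index of $W$). A set is $\Pi^0_n(A)$ if its complement is $\Sigma^0_n(A)$. A set is $\Sigma^0_{n+1}(A)$ if it equals $\bigcup_{i\in W}(X\setminus U^n_i)$ for some $A$-c.e. $W\subseteq\mathbb N$, where $U^n_i$ is the $i$-th $\Sigma^0_n(A)$ set. Omit $(A)$ when $A=\emptyset$. For $D\subseteq X$, a subset of $D$ is $\Sigma^0_1$ in $D$ if it is the intersection of $D$ with a $\Sigma^0_1$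 subset of $X$. A computable probability space $(X,\mu)$ is a computable metric space with a Borel probability measure $\mu$ such that $\mu(\bigcup_{i\in F}B_i)$ is lower-semicomputable uniformly in finite $F\subseteq\mathbb N$. A point $x\in X$ is weakly $\Pi^0_1$-generic relative to $A$ if for any $\Pi^0_1(A)$ set $P\ni x$ there is a $\Sigma^0_1$ set $U\subseteq P$ with $\mu(U)>0$. For $n\ge 2$, $x$ is weakly $\Pi^0_n$-generic relative to $A$ if for any $\Pi^0_n(A)$ set $P\ni x$ there is a $\Pi^0_1(A^{(n-2)})$ set $Q\subseteq P$ with $\mu(Q)>0$. A measure-preserving transformation is a partial Borel measurable map $T:\subseteq X\to X$ such that $\mu(T^{-1}(B))=\mu(B)$ for every Borel $B$ (so $\operatorname{dom}T$ has full measure) and $x\in\operatorname{dom}T$ implies $T(x)\in\operatorname{dom}T$. It is computable if the sets $T^{-1}(B_i)$ are uniformly $\Sigma^0_1$ in $\operatorname{dom}T$. It is ergodic if every Borel $B$ with $T^{-1}(B)=B$ has measure $0$ or $1$. *)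

theory Defs
  imports "HOL-Probability.Probability" "HOL-Library.Nat_Bijection"
begin

section \<open>Computability relative to an oracle\<close>

text \<open>
  Programs for partial recursive functions with an oracle. All functions are unary; several
  arguments are packed with the pairing function \<^const>\<open>prod_encode\<close>. The identity is
  \<open>Tup Fst Snd\<close>.
\<close>

datatype prog =
    Zero
  | Succ
  | Fst
  | Snd
  | Oracle
  | Tup prog prog
  | Cmp prog prog
  | PRec prog prog
  | Mu prog

primrec eval :: "nat set \<Rightarrow> prog \<Rightarrow> nat \<rightharpoonup> nat" where
  "eval A Zero = (\<lambda>x. Some 0)"
| "eval A Succ = (\<lambda>x. Some (Suc x))"
| "eval A Fst = (\<lambda>x. Some (fst (prod_decode x)))"
| "eval A Snd = (\<lambda>x. Some (snd (prod_decode x)))"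
| "eval A Oracle = (\<lambda>x. Some (if x \<in> A then 1 else 0))"
| "eval A (Tup p q) =
    (\<lambda>x. Option.bind (eval A p x) (\<lambda>y. Option.bind (eval A q x) (\<lambda>z. Some (prod_encode (y, z)))))"
| "eval A (Cmp p q) = (\<lambda>x. Option.bind (eval A q x) (eval A p))"
| "eval A (PRec p q) =
    (\<lambda>x. case prod_decode x of (a, m) \<Rightarrow>
      rec_nat (eval A p a)
        (\<lambda>k r. Option.bind r (\<lambda>y. eval A q (prod_encode (a, prod_encode (k, y))))) m)"
| "eval A (Mu p) =
    (\<lambda>x. if \<exists>m. eval A p (prod_encode (x, m)) = Some 0 \<and>
               (\<forall>k<m. eval A p (prod_encode (x, k)) \<noteq> None)
         then Some (LEAST m. eval A p (prod_encode (x, m)) = Some 0)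
         else None)"

primrec code :: "prog \<Rightarrow> nat" where
  "code Zero = 0"
| "code Succ = 1"
| "code Fst = 2"
| "code Snd = 3"
| "code Oracle = 4"
| "code (Tup p q) = 5 + 4 * prod_encode (code p, code q)"
| "code (Cmp p q) = 6 + 4 * prod_encode (code p, code q)"
| "code (PRec p q) = 7 + 4 * prod_encode (code p, code q)"
| "code (Mu p) = 8 + 4 * code p"

lemma inj_code: "inj code"
proof (rule injI)
  show "p = q" if "code p = code q" for p q
    using that
  proof (induction p arbitrary: q)
    case Zero then show ?case by (cases q) auto
  next
    case Succ then show ?case by (cases q) auto
  next
    case Fst then show ?case by (cases q) auto
  next
    case Snd then show ?case by (cases q) auto
  next
    case Oracle then show ?case by (cases q) auto
  next
    case (Tup p1 p2) from Tup.prems show ?case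
      by (cases q; simp; (presburger | auto dest!: Tup.IH))
  next
    case (Cmp p1 p2) from Cmp.prems show ?case
      by (cases q; simp; (presburger | auto dest!: Cmp.IH))
  next
    case (PRec p1 p2) from PRec.prems show ?case
      by (cases q; simp; (presburger | auto dest!: PRec.IH))
  next
    case (Mu p) from Mu.prems show ?case
      by (cases q; simp; (presburger | auto dest!: Mu.IH))
  qed
qed

lemma surj_code: "surj code"
proof -
  have "\<exists>p. code p = e" for e
  proof (induction e rule: less_induct)
    case (less e)
    have mod4: "\<exists>m. e = 5 + 4 * m \<or> e = 6 + 4 * m \<or> e = 7 + 4 * m \<or> e = 8 + 4 * m"
      if "e \<ge> 5" using that by presburger
    have "e = 0 \<or> e = 1 \<or> e = 2 \<or> e = 3 \<or> e = 4 \<or> e \<ge> 5" by linarith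
    then consider "e = 0" | "e = 1" | "e = 2" | "e = 3" | "e = 4"
      | m where "e = 5 + 4 * m" | m where "e = 6 + 4 * m"
      | m where "e = 7 + 4 * m" | m where "e = 8 + 4 * m"
      using mod4 by blast
    moreover have pair: "\<exists>p q. m = prod_encode (code p, code q)" if "m < e" for m
    proof -
      obtain a b where ab: "prod_decode m = (a, b)" by fastforce
      then have m: "m = prod_encode (a, b)" by (metis prod_decode_inverse)
      then have "a < e" "b < e"
        using that le_prod_encode_1[of a b] le_prod_encode_2[of b a] by auto
      then show ?thesis using less.IH m by metis
    qed
    ultimately show ?case
    proof cases
      case 1 then show ?thesis by (metis code.simps(1))
    next
      case 2 then show ?thesis by (metis code.simps(2))
    next
      case 3 then show ?thesis by (metis code.simps(3))
    next
      case 4 then show ?thesis by (metis code.simps(4))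
    next
      case 5 then show ?thesis by (metis code.simps(5))
    next
      case (6 m) then have "m < e" by simp
      then show ?thesis using pair[of m] 6 by (metis code.simps(6))
    next
      case (7 m) then have "m < e" by simp
      then show ?thesis using pair[of m] 7 by (metis code.simps(7))
    next
      case (8 m) then have "m < e" by simp
      then show ?thesis using pair[of m] 8 by (metis code.simps(8))
    next
      case (9 m) then have "m < e" by simp
      then show ?thesis using less.IH[of m] 9 by (metis code.simps(9))
    qed
  qed
  then show ?thesis by (metis surj_def)
qed

definition phi :: "nat set \<Rightarrow> nat \<Rightarrow> nat \<rightharpoonup> nat" where
  "phi A e = eval A (inv code e)"

definition ce :: "nat set \<Rightarrow> nat \<Rightarrow> nat set" where
  "ce A e = dom (phi A e)"

definition jump :: "nat set \<Rightarrow> nat set" where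
  "jump A = {e. e \<in> ce A e}"

definition computable :: "(nat \<Rightarrow> nat) \<Rightarrow> bool" where
  "computable f \<longleftrightarrow> (\<exists>e. \<forall>x. phi {} e x = Some (f x))"

text \<open>\<open>R i e\<close> reads: \<open>e\<close> is an index witnessing the property for the \<open>i\<close>-th object.\<close>

definition uniformly :: "(nat \<Rightarrow> nat \<Rightarrow> bool) \<Rightarrow> bool" where
  "uniformly R \<longleftrightarrow> (\<exists>f. computable f \<and> (\<forall>i. R i (f i)))"

definition enum_pos_rat :: "nat \<Rightarrow> real" where
  "enum_pos_rat j = (case prod_decode j of (a, b) \<Rightarrow> real (Suc a) / real (Suc b))"

definition enum_rat :: "nat \<Rightarrow> real" where
  "enum_rat j = (case prod_decode j of (a, b) \<Rightarrow> real_of_int (int_decode a) / real (Suc b))"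

definition computable_real_index :: "nat \<Rightarrow> real \<Rightarrow> bool" where
  "computable_real_index e r \<longleftrightarrow> (\<forall>k. \<exists>j. phi {} e k = Some j \<and> \<bar>enum_rat j - r\<bar> \<le> 1 / 2 ^ k)"

definition lower_semicomputable_index :: "nat \<Rightarrow> real \<Rightarrow> bool" where
  "lower_semicomputable_index e r \<longleftrightarrow> ce {} e = {j. enum_rat j < r}"


section \<open>Computable metric spaces and the effective Borel hierarchy\<close>

text \<open>The complete separable metric space is the whole type, with \<^const>\<open>dist\<close> as metric.\<close>

definition computable_metric_space :: "(nat \<Rightarrow> 'a::polish_space) \<Rightarrow> bool" where
  "computable_metric_space s \<longleftrightarrow>
    closure (range s) = UNIV \<and>
    uniformly (\<lambda>ij e. case prod_decode ij of (i, j) \<Rightarrow>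
      computable_real_index e (dist (s i) (s j)))"

definition ideal_ball :: "(nat \<Rightarrow> 'a::polish_space) \<Rightarrow> nat \<Rightarrow> 'a set" where
  "ideal_ball s m = (case prod_decode m of (i, j) \<Rightarrow> {x. dist x (s i) < enum_pos_rat j})"

text \<open>
  \<open>Sigma_set s A n e\<close> is the \<open>e\<close>-th set of class \<open>\<Sigma>\<^sup>0\<^sub>n(A)\<close>. The hierarchy
  starts at \<open>n = 1\<close>; the value at \<open>n = 0\<close> carries no meaning.
\<close>

fun Sigma_set :: "(nat \<Rightarrow> 'a::polish_space) \<Rightarrow> nat set \<Rightarrow> nat \<Rightarrow> nat \<Rightarrow> 'a set" where
  "Sigma_set s A 0 e = {}"
| "Sigma_set s A (Suc 0) e = (\<Union>i\<in>ce A e. ideal_ball s i)"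
| "Sigma_set s A (Suc (Suc n)) e = (\<Union>i\<in>ce A e. - Sigma_set s A (Suc n) i)"

definition is_Sigma :: "(nat \<Rightarrow> 'a::polish_space) \<Rightarrow> nat set \<Rightarrow> nat \<Rightarrow> 'a set \<Rightarrow> bool" where
  "is_Sigma s A n U \<longleftrightarrow> (\<exists>e. U = Sigma_set s A n e)"

definition is_Pi :: "(nat \<Rightarrow> 'a::polish_space) \<Rightarrow> nat set \<Rightarrow> nat \<Rightarrow> 'a set \<Rightarrow> bool" where
  "is_Pi s A n P \<longleftrightarrow> is_Sigma s A n (- P)"


section \<open>Computable probability spaces and genericity\<close>

text \<open>Finite sets of naturals are given by their canonical index, decoded by \<^const>\<open>set_decode\<close>.\<close>

definition computable_prob_space :: "(nat \<Rightarrow> 'a::polish_space) \<Rightarrow> 'a measure \<Rightarrow> bool" where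
  "computable_prob_space s \<mu> \<longleftrightarrow>
    computable_metric_space s \<and> prob_space \<mu> \<and> sets \<mu> = sets borel \<and>
    uniformly (\<lambda>u e. lower_semicomputable_index e
      (measure \<mu> (\<Union>i\<in>set_decode u. ideal_ball s i)))"

text \<open>
  For \<open>n = 1\<close> the set \<open>U\<close> is \<open>\<Sigma>\<^sup>0\<^sub>1\<close> without oracle. The second branch is meant for
  \<open>n \<ge> 2\<close>.
\<close>

definition weakly_Pi_generic ::
  "(nat \<Rightarrow> 'a::polish_space) \<Rightarrow> 'a measure \<Rightarrow> nat \<Rightarrow> nat set \<Rightarrow> 'a \<Rightarrow> bool" where
  "weakly_Pi_generic s \<mu> n A x \<longleftrightarrow>
    (if n = 1 then
       (\<forall>P. is_Pi s A 1 P \<and> x \<in> P \<longrightarrow>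
         (\<exists>U. is_Sigma s {} 1 U \<and> U \<subseteq> P \<and> measure \<mu> U > 0))
     else
       (\<forall>P. is_Pi s A n P \<and> x \<in> P \<longrightarrow>
         (\<exists>Q. is_Pi s ((jump ^^ (n - 2)) A) 1 Q \<and> Q \<subseteq> P \<and> measure \<mu> Q > 0)))"


section \<open>Partial transformations\<close>

definition preimage :: "('a \<rightharpoonup> 'a) \<Rightarrow> 'a set \<Rightarrow> 'a set" where
  "preimage T B = {x. \<exists>y\<in>B. T x = Some y}"

definition iterate :: "('a \<rightharpoonup> 'a) \<Rightarrow> nat \<Rightarrow> 'a \<rightharpoonup> 'a" where
  "iterate T k x = ((\<lambda>z. Option.bind z T) ^^ k) (Some x)"

definition measure_preserving :: "'a::topological_space measure \<Rightarrow> ('a \<rightharpoonup> 'a) \<Rightarrow> bool" where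
  "measure_preserving \<mu> T \<longleftrightarrow>
    (\<forall>B\<in>sets borel. preimage T B \<in> sets borel \<and> measure \<mu> (preimage T B) = measure \<mu> B) \<and>
    ran T \<subseteq> dom T"

definition computable_map :: "(nat \<Rightarrow> 'a::polish_space) \<Rightarrow> ('a \<rightharpoonup> 'a) \<Rightarrow> bool" where
  "computable_map s T \<longleftrightarrow>
    uniformly (\<lambda>i e. preimage T (ideal_ball s i) = dom T \<inter> Sigma_set s {} 1 e)"

definition ergodic :: "'a::topological_space measure \<Rightarrow> ('a \<rightharpoonup> 'a) \<Rightarrow> bool" where
  "ergodic \<mu> T \<longleftrightarrow>
    (\<forall>B\<in>sets borel. preimage T B = B \<longrightarrow> measure \<mu> B = 0 \<or> measure \<mu> B = 1)"

end

theory Submission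
  imports Defs
begin

text \<open>
  For \<open>Q \<subseteq> P\<close> of positive measure as provided by genericity (\<open>\<Sigma>\<^sup>0\<^sub>1\<close> if \<open>n = 1\<close>,
  \<open>\<Pi>\<^sup>0\<^sub>1(A\<^sup>(\<^sup>n\<^sup>-\<^sup>2\<^sup>))\<close> if \<open>n \<ge> 2\<close>), let \<open>W\<close> be the set of points that \<open>T\<close> moves into \<open>Q\<close> at some positive
  time. By recurrence and ergodicity \<open>W\<close> has full measure. Since \<open>T\<close> is computable, \<open>W = dom T \<inter> V\<close>
  with \<open>V\<close> of class \<open>\<Sigma>\<^sup>0\<^sub>1\<close>, respectively \<open>\<Sigma>\<^sup>0\<^sub>2(A\<^sup>(\<^sup>n\<^sup>-\<^sup>2\<^sup>)) \<subseteq> \<Sigma>\<^sup>0\<^sub>n(A)\<close>. If \<open>x\<close> were outside \<open>V\<close>,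
  genericity would yield a set of positive measure in the complement of \<open>V\<close>, which is null.

  The inclusion of classes rests on \<open>\<Sigma>\<^sup>0\<^sub>m(A') \<subseteq> \<Sigma>\<^sup>0\<^sub>m\<^sub>+\<^sub>1(A)\<close>, uniformly in indices. It needs a
  universal machine with stages (the stage \<open>t\<close> is a finite set of triples program, input, output,
  computed from the stage \<open>t - 1\<close>), the s-m-n theorem, and the limit approximation of the jump.
\<close>

section \<open>Functions and relations recursive in an oracle\<close>

abbreviation pi1 :: "nat \<Rightarrow> nat" where "pi1 z \<equiv> fst (prod_decode z)"
abbreviation pi2 :: "nat \<Rightarrow> nat" where "pi2 z \<equiv> snd (prod_decode z)"

definition recursive_in :: "nat set \<Rightarrow> (nat \<Rightarrow> nat) \<Rightarrow> bool" where
  "recursive_in A f \<longleftrightarrow> (\<exists>p. \<forall>x. eval A p x = Some (f x))"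

definition decidable_in :: "nat set \<Rightarrow> (nat \<Rightarrow> bool) \<Rightarrow> bool" where
  "decidable_in A P \<longleftrightarrow> recursive_in A (\<lambda>x. of_bool (P x))"

named_theorems rec_intros

section \<open>Closure properties of recursive functions\<close>

lemma recursive_in_id [rec_intros]: "recursive_in A (\<lambda>x. x)"
  unfolding recursive_in_def by (rule exI[of _ "Tup Fst Snd"]) simp

lemma recursive_in_Suc [rec_intros]: "recursive_in A f \<Longrightarrow> recursive_in A (\<lambda>x. Suc (f x))"
  unfolding recursive_in_def
proof (elim exE)
  fix p assume "\<forall>x. eval A p x = Some (f x)"
  then have "\<forall>x. eval A (Cmp Succ p) x = Some (Suc (f x))" by simp
  then show "\<exists>p. \<forall>x. eval A p x = Some (Suc (f x))" by blast
qed

lemma recursive_in_const [rec_intros]: "recursive_in A (\<lambda>x. c)"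
proof (induction c)
  case 0
  show ?case unfolding recursive_in_def by (rule exI[of _ Zero]) simp
qed (rule recursive_in_Suc)

lemma recursive_in_comp:
  assumes "recursive_in A f" "recursive_in A g" shows "recursive_in A (\<lambda>x. f (g x))"
proof -
  obtain p q where "\<forall>x. eval A p x = Some (f x)" "\<forall>x. eval A q x = Some (g x)"
    using assms unfolding recursive_in_def by blast
  then have "\<forall>x. eval A (Cmp p q) x = Some (f (g x))" by simp
  then show ?thesis unfolding recursive_in_def by blast
qed

lemma recursive_in_pi1 [rec_intros]: "recursive_in A f \<Longrightarrow> recursive_in A (\<lambda>x. pi1 (f x))"
  by (rule recursive_in_comp[of A pi1]) (auto simp: recursive_in_def intro: exI[of _ Fst])

lemma recursive_in_pi2 [rec_intros]: "recursive_in A f \<Longrightarrow> recursive_in A (\<lambda>x. pi2 (f x))"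
  by (rule recursive_in_comp[of A pi2]) (auto simp: recursive_in_def intro: exI[of _ Snd])

lemma recursive_in_pair [rec_intros]:
  assumes "recursive_in A f" "recursive_in A g"
  shows "recursive_in A (\<lambda>x. prod_encode (f x, g x))"
proof -
  obtain p q where "\<forall>x. eval A p x = Some (f x)" "\<forall>x. eval A q x = Some (g x)"
    using assms unfolding recursive_in_def by blast
  then have "\<forall>x. eval A (Tup p q) x = Some (prod_encode (f x, g x))" by simp
  then show ?thesis unfolding recursive_in_def by blast
qed

text \<open>\<open>PRec\<close> carries its parameter along in the pair \<open>(a, m)\<close>, so
  the start value and the step may both depend on the outer argument \<open>x\<close>. All
  arithmetic below is derived from this rule.\<close>

lemma recursive_in_rec_nat [rec_intros]:
  assumes f: "recursive_in A f"
    and h: "recursive_in A (\<lambda>z. h (pi1 z) (pi1 (pi2 z)) (pi2 (pi2 z)))"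
    and m: "recursive_in A m"
  shows "recursive_in A (\<lambda>x. rec_nat (f x) (\<lambda>k r. h x k r) (m x))"
proof -
  obtain p q where pq: "\<forall>x. eval A p x = Some (f x)"
    "\<forall>z. eval A q z = Some (h (pi1 z) (pi1 (pi2 z)) (pi2 (pi2 z)))"
    using f h unfolding recursive_in_def by blast
  have "eval A (PRec p q) (prod_encode (a, n)) = Some (rec_nat (f a) (\<lambda>k r. h a k r) n)" for a n
    by (induction n) (use pq in simp_all)
  then have "eval A (PRec p q) z = Some (rec_nat (f (pi1 z)) (\<lambda>k r. h (pi1 z) k r) (pi2 z))" for z
    by (metis prod.collapse prod_decode_inverse)
  then have "recursive_in A (\<lambda>z. rec_nat (f (pi1 z)) (\<lambda>k r. h (pi1 z) k r) (pi2 z))"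
    unfolding recursive_in_def by blast
  from recursive_in_comp[OF this recursive_in_pair[OF recursive_in_id m]] show ?thesis by simp
qed

lemma recursive_in_add [rec_intros]:
  assumes "recursive_in A f" "recursive_in A g" shows "recursive_in A (\<lambda>x. f x + g x)"
proof -
  have "recursive_in A (\<lambda>x. rec_nat (f x) (\<lambda>k r. Suc r) (g x))"
    by (intro rec_intros assms)
  moreover have "rec_nat a (\<lambda>k r. Suc r) b = a + b" for a b by (induction b) auto
  ultimately show ?thesis by simp
qed

lemma recursive_in_diff [rec_intros]:
  assumes "recursive_in A f" "recursive_in A g" shows "recursive_in A (\<lambda>x. f x - g x)"
proof -
  \<comment> \<open>The inner recursion, which returns its counter, is the predecessor; truncated
    subtraction iterates it.\<close>
  have "recursive_in A (\<lambda>x. rec_nat (f x) (\<lambda>k r. rec_nat 0 (\<lambda>k r. k) r) (g x))"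
    by (intro rec_intros assms)
  moreover have pred: "rec_nat 0 (\<lambda>k r. k) b = b - 1" for b :: nat by (cases b) auto
  moreover have "rec_nat a (\<lambda>k r. r - 1) b = a - b" for a b :: nat by (induction b) auto
  ultimately show ?thesis by simp
qed

lemma recursive_in_mult [rec_intros]:
  assumes "recursive_in A f" "recursive_in A g" shows "recursive_in A (\<lambda>x. f x * g x)"
proof -
  have "recursive_in A (\<lambda>x. rec_nat 0 (\<lambda>k r. r + f x) (g x))"
    by (intro rec_intros assms recursive_in_comp[OF assms(1)])
  moreover have "rec_nat 0 (\<lambda>k r. r + a) b = a * b" for a b :: nat by (induction b) auto
  ultimately show ?thesis by simp
qed

lemma recursive_in_power [rec_intros]:
  assumes "recursive_in A f" "recursive_in A g" shows "recursive_in A (\<lambda>x. f x ^ g x)"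
proof -
  have "recursive_in A (\<lambda>x. rec_nat 1 (\<lambda>k r. r * f x) (g x))"
    by (intro rec_intros assms recursive_in_comp[OF assms(1)])
  moreover have "rec_nat 1 (\<lambda>k r. r * a) b = a ^ b" for a b :: nat by (induction b) auto
  ultimately show ?thesis by simp
qed

lemma recursive_in_sum [rec_intros]:
  assumes "recursive_in A n" "recursive_in A (\<lambda>z. f (pi1 z) (pi2 z))"
  shows "recursive_in A (\<lambda>x. \<Sum>k<n x. f x k)"
proof -
  have f: "recursive_in A u \<Longrightarrow> recursive_in A v \<Longrightarrow> recursive_in A (\<lambda>x. f (u x) (v x))" for u v
    using recursive_in_comp[OF assms(2) recursive_in_pair[of A u v]] by simp
  have "recursive_in A (\<lambda>x. rec_nat 0 (\<lambda>k r. r + f x k) (n x))"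
    by (intro rec_intros assms f)
  moreover have "rec_nat 0 (\<lambda>k r. r + f x k) b = (\<Sum>k<b. f x k)" for x b by (induction b) auto
  ultimately show ?thesis by simp
qed

lemma recursive_in_funpow [rec_intros]:
  assumes "recursive_in A g" "recursive_in A f" "recursive_in A n"
  shows "recursive_in A (\<lambda>x. (g ^^ n x) (f x))"
proof -
  have "recursive_in A (\<lambda>x. rec_nat (f x) (\<lambda>k r. g r) (n x))"
    by (intro rec_intros assms recursive_in_comp[OF assms(1)])
  moreover have "rec_nat a (\<lambda>k r. g r) b = (g ^^ b) a" for a b by (induction b) auto
  ultimately show ?thesis by simp
qed

section \<open>Decidable relations\<close>

lemma recursive_in_of_bool [rec_intros]: "decidable_in A P \<Longrightarrow> recursive_in A (\<lambda>x. of_bool (P x))"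
  by (simp add: decidable_in_def)

lemma decidable_in_const [rec_intros]: "decidable_in A (\<lambda>x. c)"
  unfolding decidable_in_def by (rule recursive_in_const)

lemma decidable_in_oracle: "decidable_in A (\<lambda>x. x \<in> A)"
  unfolding decidable_in_def recursive_in_def by (rule exI[of _ Oracle]) simp

lemma decidable_in_comp: "decidable_in A P \<Longrightarrow> recursive_in A f \<Longrightarrow> decidable_in A (\<lambda>x. P (f x))"
  unfolding decidable_in_def by (rule recursive_in_comp)

lemma decidable_in_not [rec_intros]:
  assumes "decidable_in A P" shows "decidable_in A (\<lambda>x. \<not> P x)"
proof -
  have "recursive_in A (\<lambda>x. 1 - of_bool (P x))" by (intro rec_intros assms)
  moreover have "1 - of_bool p = (of_bool (\<not> p) :: nat)" for p by simp
  ultimately show ?thesis by (simp add: decidable_in_def)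
qed

lemma decidable_in_conj [rec_intros]:
  assumes "decidable_in A P" "decidable_in A Q" shows "decidable_in A (\<lambda>x. P x \<and> Q x)"
proof -
  have "recursive_in A (\<lambda>x. of_bool (P x) * of_bool (Q x))" by (intro rec_intros assms)
  then show ?thesis by (simp add: decidable_in_def of_bool_conj)
qed

lemma decidable_in_disj [rec_intros]:
  assumes "decidable_in A P" "decidable_in A Q" shows "decidable_in A (\<lambda>x. P x \<or> Q x)"
proof -
  have "decidable_in A (\<lambda>x. \<not> (\<not> P x \<and> \<not> Q x))" by (intro rec_intros assms)
  then show ?thesis by simp
qed

lemma decidable_in_less [rec_intros]:
  assumes "recursive_in A f" "recursive_in A g" shows "decidable_in A (\<lambda>x. f x < g x)"
proof -
  have "recursive_in A (\<lambda>x. 1 - (1 - (g x - f x)))" by (intro rec_intros assms)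
  moreover have "1 - (1 - (b - a)) = of_bool (a < b)" for a b :: nat by simp
  ultimately show ?thesis by (simp add: decidable_in_def)
qed

lemma decidable_in_le [rec_intros]:
  assumes "recursive_in A f" "recursive_in A g" shows "decidable_in A (\<lambda>x. f x \<le> g x)"
proof -
  have "decidable_in A (\<lambda>x. f x < Suc (g x))" by (intro rec_intros assms)
  then show ?thesis by (simp add: less_Suc_eq_le)
qed

lemma decidable_in_eq [rec_intros]:
  assumes "recursive_in A f" "recursive_in A g" shows "decidable_in A (\<lambda>x. f x = g x)"
proof -
  have "decidable_in A (\<lambda>x. f x \<le> g x \<and> g x \<le> f x)" by (intro rec_intros assms)
  then show ?thesis by (simp add: order_eq_iff)
qed

lemma decidable_in_ex_less [rec_intros]:
  assumes "recursive_in A n" "decidable_in A (\<lambda>z. P (pi1 z) (pi2 z))"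
  shows "decidable_in A (\<lambda>x. \<exists>k<n x. P x k)"
proof -
  have "decidable_in A (\<lambda>x. 0 < (\<Sum>k<n x. of_bool (P x k) :: nat))"
    by (intro rec_intros assms)
  moreover have "0 < (\<Sum>k<n x. of_bool (P x k) :: nat) \<longleftrightarrow> (\<exists>k<n x. P x k)" for x
    by (auto simp flip: neq0_conv)
  ultimately show ?thesis by simp
qed

lemma decidable_in_all_less [rec_intros]:
  assumes "recursive_in A n" "decidable_in A (\<lambda>z. P (pi1 z) (pi2 z))"
  shows "decidable_in A (\<lambda>x. \<forall>k<n x. P x k)"
proof -
  have "decidable_in A (\<lambda>x. \<not> (\<exists>k<n x. \<not> P x k))" by (intro rec_intros assms)
  then show ?thesis by simp
qed

lemma recursive_in_half [rec_intros]:
  assumes "recursive_in A f" shows "recursive_in A (\<lambda>x. f x div 2)"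
proof -
  \<comment> \<open>The inner recursion is the parity of \<open>k\<close>; \<open>b div 2\<close> is
    the number of odd \<open>k\<close> below \<open>b\<close>.\<close>
  have "recursive_in A (\<lambda>x. rec_nat 0 (\<lambda>k r. r + rec_nat 0 (\<lambda>k r. 1 - r) k) (f x))"
    by (intro rec_intros assms)
  moreover have parity: "rec_nat 0 (\<lambda>k r. 1 - r) b = b mod 2" for b :: nat
    by (induction b) (simp_all, presburger)
  moreover have "rec_nat 0 (\<lambda>k r. r + k mod 2) b = b div 2" for b :: nat
    by (induction b) (simp_all, presburger)
  ultimately show ?thesis by simp
qed

lemma decidable_in_set_decode [rec_intros]:
  assumes "recursive_in A f" "recursive_in A g" shows "decidable_in A (\<lambda>x. f x \<in> set_decode (g x))"
proof -
  \<comment> \<open>Repeated halving shifts bit \<open>f x\<close> of \<open>g x\<close> to the last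
    place, where membership becomes oddness.\<close>
  have "decidable_in A (\<lambda>x. rec_nat (g x) (\<lambda>k r. r div 2) (f x)
      \<noteq> 2 * (rec_nat (g x) (\<lambda>k r. r div 2) (f x) div 2))"
    by (intro rec_intros assms)
  moreover have "rec_nat a (\<lambda>k r. r div 2) b = a div 2 ^ b" for a b :: nat
    by (induction b) (simp_all add: div_mult2_eq[symmetric] mult.commute)
  moreover have "a \<noteq> 2 * (a div 2) \<longleftrightarrow> odd a" for a :: nat by presburger
  ultimately show ?thesis by (simp add: set_decode_def)
qed

text \<open>Brings the code of a bounded set into a form to which \<open>recursive_in_sum\<close>
  applies; \<open>stage_code\<close> is built on it.\<close>

lemma set_encode_initial: "set_encode {z. z < n \<and> P z} = (\<Sum>z<n. of_bool (P z) * 2 ^ z)"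
proof -
  have "(\<Sum>z<n. of_bool (P z) * 2 ^ z) = (\<Sum>z<n. if P z then 2 ^ z else (0::nat))"
    by (intro sum.cong) auto
  also have "\<dots> = (\<Sum>z\<in>{z \<in> {..<n}. P z}. 2 ^ z)" by (rule sum.inter_filter[symmetric]) simp
  finally show ?thesis by (simp add: set_encode_def)
qed

section \<open>Passing from the empty oracle to an arbitrary one\<close>

primrec oracle_free :: "prog \<Rightarrow> prog" where
  "oracle_free Zero = Zero"
| "oracle_free Succ = Succ"
| "oracle_free Fst = Fst"
| "oracle_free Snd = Snd"
| "oracle_free Oracle = Zero"
| "oracle_free (Tup p q) = Tup (oracle_free p) (oracle_free q)"
| "oracle_free (Cmp p q) = Cmp (oracle_free p) (oracle_free q)"
| "oracle_free (PRec p q) = PRec (oracle_free p) (oracle_free q)"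
| "oracle_free (Mu p) = Mu (oracle_free p)"

text \<open>The empty oracle answers 0 to every query, which is what \<open>Zero\<close>
  returns.\<close>

lemma eval_oracle_free: "eval A (oracle_free p) = eval {} p"
  by (induction p) (simp_all only: oracle_free.simps eval.simps empty_iff if_False)

lemma recursive_in_empty: "recursive_in {} f \<Longrightarrow> recursive_in A f"
  unfolding recursive_in_def by (metis eval_oracle_free)

lemma decidable_in_empty: "decidable_in {} P \<Longrightarrow> decidable_in A P"
  unfolding decidable_in_def by (rule recursive_in_empty)

lemma phi_code [simp]: "phi A (code p) = eval A p"
  by (simp add: phi_def inj_code)

lemma recursive_in_computable: "computable f \<Longrightarrow> recursive_in A f"
  by (rule recursive_in_empty) (auto simp: computable_def recursive_in_def phi_def)

section \<open>Universal computation by stages\<close>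

abbreviation triple :: "nat \<Rightarrow> nat \<Rightarrow> nat \<Rightarrow> nat" where
  "triple e x y \<equiv> prod_encode (e, prod_encode (x, y))"

text \<open>One application of the evaluation rules to program codes, with \<open>S\<close> as the
  triples already established. \<open>S\<close> occurs only positively, which yields monotonicity;
  in the \<open>Mu\<close> clause the values \<open>r > 0\<close> express convergence and failure of
  the search at \<open>k\<close> together.\<close>

definition eval_step :: "nat set \<Rightarrow> nat set \<Rightarrow> nat \<Rightarrow> nat \<Rightarrow> nat \<Rightarrow> bool" where
  "eval_step C S e x y \<longleftrightarrow>
    e = 0 \<and> y = 0 \<or> e = 1 \<and> y = Suc x \<or> e = 2 \<and> y = pi1 x \<or> e = 3 \<and> y = pi2 x \<or>
    e = 4 \<and> y = of_bool (x \<in> C) \<or>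
    (\<exists>p q. e = 5 + 4 * prod_encode (p, q) \<and> triple p x (pi1 y) \<in> S \<and> triple q x (pi2 y) \<in> S) \<or>
    (\<exists>p q. e = 6 + 4 * prod_encode (p, q) \<and> (\<exists>a. triple q x a \<in> S \<and> triple p a y \<in> S)) \<or>
    (\<exists>p q. e = 7 + 4 * prod_encode (p, q) \<and>
      (pi2 x = 0 \<and> triple p (pi1 x) y \<in> S \<or>
       pi2 x > 0 \<and> (\<exists>r. triple e (prod_encode (pi1 x, pi2 x - 1)) r \<in> S \<and>
         triple q (triple (pi1 x) (pi2 x - 1) r) y \<in> S))) \<or>
    (\<exists>p. e = 8 + 4 * p \<and> triple p (prod_encode (x, y)) 0 \<in> S \<and>
      (\<forall>k<y. \<exists>r. r > 0 \<and> triple p (prod_encode (x, k)) r \<in> S))"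

text \<open>The bound \<open>z < t\<close> keeps each stage finite, hence codable by a number. It
  only delays a triple, since \<open>t\<close> grows without limit.\<close>

primrec stage :: "nat set \<Rightarrow> nat \<Rightarrow> nat set" where
  "stage C 0 = {}"
| "stage C (Suc t) = {z. z < t \<and> eval_step C (stage C t) (pi1 z) (pi1 (pi2 z)) (pi2 (pi2 z))}"

lemma phi_simps:
  "phi A 0 x = Some 0" "phi A (Suc 0) x = Some (Suc x)"
  "phi A 2 x = Some (pi1 x)" "phi A 3 x = Some (pi2 x)"
  "phi A 4 x = Some (of_bool (x \<in> A))"
  using phi_code[of A Zero] phi_code[of A Succ] phi_code[of A Fst] phi_code[of A Snd]
    phi_code[of A Oracle]
  by simp_all

lemma code_cases: obtains p where "e = code p"
  using surj_code by (auto simp: surj_def)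

lemma phi_Tup: "phi A (5 + 4 * prod_encode (a, b)) x =
    Option.bind (phi A a x) (\<lambda>y. Option.bind (phi A b x) (\<lambda>z. Some (prod_encode (y, z))))"
  by (cases a rule: code_cases; cases b rule: code_cases) (simp flip: code.simps(6))

lemma phi_Cmp: "phi A (6 + 4 * prod_encode (a, b)) x = Option.bind (phi A b x) (phi A a)"
  by (cases a rule: code_cases; cases b rule: code_cases) (simp flip: code.simps(7))

lemma phi_PRec:
  "phi A (7 + 4 * prod_encode (a, b)) (prod_encode (x, 0)) = phi A a x"
  "phi A (7 + 4 * prod_encode (a, b)) (prod_encode (x, Suc k)) =
    Option.bind (phi A (7 + 4 * prod_encode (a, b)) (prod_encode (x, k)))
      (\<lambda>r. phi A b (triple x k r))"
  by (cases a rule: code_cases; cases b rule: code_cases; simp flip: code.simps(8))+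

text \<open>Trades \<open>LEAST\<close> and definedness for positive statements about values, as in
  the \<open>Mu\<close> clause of \<open>eval_step\<close>.\<close>

lemma phi_Mu: "phi A (8 + 4 * a) x = Some y \<longleftrightarrow>
    phi A a (prod_encode (x, y)) = Some 0 \<and> (\<forall>k<y. \<exists>r>0. phi A a (prod_encode (x, k)) = Some r)"
    (is "?L \<longleftrightarrow> ?R")
proof -
  obtain p where a: "a = code p" by (rule code_cases)
  let ?g = "\<lambda>m. phi A a (prod_encode (x, m))"
  have eq: "phi A (8 + 4 * a) x = (if \<exists>m. ?g m = Some 0 \<and> (\<forall>k<m. ?g k \<noteq> None)
      then Some (LEAST m. ?g m = Some 0) else None)"
    by (simp add: a flip: code.simps(9))
  show ?thesis
  proof
    assume L: ?L
    then obtain m where m: "?g m = Some 0" "\<forall>k<m. ?g k \<noteq> None" and y: "y = (LEAST m. ?g m = Some 0)"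
      by (auto simp: eq split: if_splits)
    have "y \<le> m" "?g y = Some 0" using m(1) unfolding y by (auto intro: Least_le LeastI)
    moreover have "\<exists>r>0. ?g k = Some r" if "k < y" for k
    proof -
      have "?g k \<noteq> Some 0" using not_less_Least that unfolding y by blast
      moreover have "?g k \<noteq> None" using m(2) that \<open>y \<le> m\<close> by auto
      ultimately show ?thesis by (metis gr0I option.exhaust)
    qed
    ultimately show ?R by blast
  next
    assume R: ?R
    moreover from R have "(LEAST m. ?g m = Some 0) = y"
      by (intro Least_equality) (auto simp: not_less[symmetric])
    ultimately show ?L unfolding eq by force
  qed
qed

section \<open>Soundness and completeness of the stages\<close>

lemma eval_step_mono:
  assumes "eval_step C S e x y" "S \<subseteq> S'" shows "eval_step C S' e x y"
proof -
  have "z \<in> S \<longrightarrow> z \<in> S'" for z using assms(2) by blast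
  note mono = imp_refl this disj_mono conj_mono ex_mono all_mono imp_mono
  have "eval_step C S e x y \<longrightarrow> eval_step C S' e x y"
    unfolding eval_step_def by (rule mono)+
  then show ?thesis using assms(1) ..
qed

lemma stage_bounded: "stage C t \<subseteq> {..<t}"
  by (cases t) auto

lemma stage_Suc_mono: "stage C t \<subseteq> stage C (Suc t)"
proof (induction t)
  case (Suc t)
  show ?case using eval_step_mono[OF _ Suc] by (auto simp del: stage.simps(2) simp: stage.simps(2)[of C])
qed simp

lemma stage_mono: "t \<le> t' \<Longrightarrow> stage C t \<subseteq> stage C t'"
  using lift_Suc_mono_le[of "stage C"] stage_Suc_mono by blast

lemma eval_step_sound:
  assumes S: "\<And>e x y. triple e x y \<in> S \<Longrightarrow> phi C e x = Some y" and "eval_step C S e x y"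
  shows "phi C e x = Some y"
proof -
  have pair: "prod_encode (pi1 z, pi2 z) = z" for z by simp
  show ?thesis
    using assms(2) unfolding eval_step_def
  proof (elim disjE exE conjE)
    fix p q assume e: "e = 7 + 4 * prod_encode (p, q)" and "pi2 x = 0" "triple p (pi1 x) y \<in> S"
    then show ?thesis using phi_PRec(1)[of C p q "pi1 x"] S pair[of x] by simp
  next
    fix p q r assume e: "e = 7 + 4 * prod_encode (p, q)" and "0 < pi2 x"
      "triple e (prod_encode (pi1 x, pi2 x - 1)) r \<in> S"
      "triple q (triple (pi1 x) (pi2 x - 1) r) y \<in> S"
    then show ?thesis using phi_PRec(2)[of C p q "pi1 x" "pi2 x - 1"] S pair[of x] by simp
  next
    fix p assume "e = 8 + 4 * p" "triple p (prod_encode (x, y)) 0 \<in> S"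
      "\<forall>k<y. \<exists>r. r > 0 \<and> triple p (prod_encode (x, k)) r \<in> S"
    then show ?thesis using S by (auto simp: phi_Mu)
  qed (auto simp: phi_simps phi_Tup phi_Cmp dest!: S)
qed

lemma stage_sound: "triple e x y \<in> stage C t \<Longrightarrow> phi C e x = Some y"
proof (induction t arbitrary: e x y)
  case (Suc t)
  from Suc.prems have "eval_step C (stage C t) e x y" by simp
  with Suc.IH show ?case by (rule eval_step_sound)
qed simp

lemma stage_intro:
  assumes "eval_step C (stage C t) e x y" shows "\<exists>t. triple e x y \<in> stage C t"
proof -
  \<comment> \<open>The stage must be late enough for the premises and also exceed the code of the
    new triple.\<close>
  let ?t = "max t (Suc (triple e x y))"
  have "eval_step C (stage C ?t) e x y"
    using assms by (rule eval_step_mono) (simp add: stage_mono)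
  then have "triple e x y \<in> stage C (Suc ?t)" by simp
  then show ?thesis ..
qed

lemma stage_directed:
  assumes "u \<in> stage C t" "v \<in> stage C t'" obtains t where "u \<in> stage C t" "v \<in> stage C t"
  using assms stage_mono[of t "max t t'" C] stage_mono[of t' "max t t'" C] by auto

text \<open>A halting computation has finitely many subcomputations. Each appears at some stage, and
  since the stages increase, one stage contains them all.\<close>

lemma stage_complete: "eval C p x = Some y \<Longrightarrow> \<exists>t. triple (code p) x y \<in> stage C t"
proof (induction p arbitrary: x y)
  case (Tup p q)
  then obtain a b where "eval C p x = Some a" "eval C q x = Some b" and y: "y = prod_encode (a, b)"
    by (auto simp: bind_eq_Some_conv)
  then obtain t where "triple (code p) x a \<in> stage C t" "triple (code q) x b \<in> stage C t"
    using Tup.IH stage_directed by metis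
  then have "eval_step C (stage C t) (code (Tup p q)) x y"
    unfolding eval_step_def code.simps y by (auto simp del: prod_encode_eq)
  then show ?case by (rule stage_intro)
next
  case (Cmp p q)
  then obtain a where "eval C q x = Some a" "eval C p a = Some y"
    by (auto simp: bind_eq_Some_conv)
  then obtain t where "triple (code q) x a \<in> stage C t" "triple (code p) a y \<in> stage C t"
    using Cmp.IH stage_directed by metis
  then have "eval_step C (stage C t) (code (Cmp p q)) x y"
    unfolding eval_step_def code.simps by blast
  then show ?case by (rule stage_intro)
next
  case (PRec p q)
  \<comment> \<open>At \<open>Suc m\<close> the program calls itself at \<open>m\<close>, which
    structural induction does not reach; hence an inner induction on the counter.\<close>
  have "eval C (PRec p q) (prod_encode (a, m)) = Some y
    \<Longrightarrow> \<exists>t. triple (code (PRec p q)) (prod_encode (a, m)) y \<in> stage C t" for a m y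
  proof (induction m arbitrary: y)
    case 0
    then obtain t where "triple (code p) a y \<in> stage C t" using PRec.IH(1) by auto
    then have "eval_step C (stage C t) (code (PRec p q)) (prod_encode (a, 0)) y"
      unfolding eval_step_def code.simps by auto
    then show ?case by (rule stage_intro)
  next
    case (Suc m)
    then obtain r where "eval C (PRec p q) (prod_encode (a, m)) = Some r"
      "eval C q (triple a m r) = Some y"
      by (auto simp: bind_eq_Some_conv)
    then obtain t where "triple (code (PRec p q)) (prod_encode (a, m)) r \<in> stage C t"
      "triple (code q) (triple a m r) y \<in> stage C t"
      using Suc.IH PRec.IH(2) stage_directed by metis
    then have "eval_step C (stage C t) (code (PRec p q)) (prod_encode (a, Suc m)) y"
      unfolding eval_step_def code.simps by auto
    then show ?case by (rule stage_intro)
  qed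
  then show ?case using PRec.prems by (metis prod.collapse prod_decode_inverse)
next
  case (Mu p)
  then have y: "eval C p (prod_encode (x, y)) = Some 0"
    and less: "\<And>k. k < y \<Longrightarrow> \<exists>r>0. eval C p (prod_encode (x, k)) = Some r"
    using phi_Mu[of C "code p" x y] by (auto simp flip: code.simps(9))
  \<comment> \<open>The values below \<open>y\<close> may appear at different stages; induction on
    \<open>m\<close> finds a common one.\<close>
  have "\<exists>t. \<forall>k<m. \<exists>r>0. triple (code p) (prod_encode (x, k)) r \<in> stage C t" if "m \<le> y" for m
    using that
  proof (induction m)
    case (Suc m)
    then obtain t where t: "\<forall>k<m. \<exists>r>0. triple (code p) (prod_encode (x, k)) r \<in> stage C t" by auto
    obtain r where "r > 0" "eval C p (prod_encode (x, m)) = Some r" using less[of m] Suc.prems by auto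
    then obtain t' where t': "triple (code p) (prod_encode (x, m)) r \<in> stage C t'"
      using Mu.IH by blast
    have "\<exists>r>0. triple (code p) (prod_encode (x, k)) r \<in> stage C (max t t')" if "k < Suc m" for k
      using that t t' \<open>r > 0\<close> stage_mono[of t "max t t'" C] stage_mono[of t' "max t t'" C]
      by (fastforce simp: less_Suc_eq)
    then show ?case by blast
  qed simp
  then obtain t where t: "\<forall>k<y. \<exists>r>0. triple (code p) (prod_encode (x, k)) r \<in> stage C t" by blast
  obtain t' where t': "triple (code p) (prod_encode (x, y)) 0 \<in> stage C t'" using Mu.IH y by blast
  have "\<forall>k<y. \<exists>r>0. triple (code p) (prod_encode (x, k)) r \<in> stage C (max t t')"
    using t stage_mono[of t "max t t'" C] by fastforce
  moreover have "triple (code p) (prod_encode (x, y)) 0 \<in> stage C (max t t')"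
    using t' stage_mono[of t' "max t t'" C] by auto
  ultimately have "eval_step C (stage C (max t t')) (code (Mu p)) x y"
    unfolding eval_step_def code.simps by auto
  then show ?case by (rule stage_intro)
\<comment> \<open>Atomic programs have no premises, so the empty stage suffices.\<close>
qed (rule stage_intro[of _ 0], simp add: eval_step_def)+

lemma phi_iff_stage: "phi C e x = Some y \<longleftrightarrow> (\<exists>t. triple e x y \<in> stage C t)"
  by (cases e rule: code_cases) (metis phi_code stage_complete stage_sound)

lemma ce_iff_stage: "x \<in> ce C e \<longleftrightarrow> (\<exists>t y. triple e x y \<in> stage C t)"
  by (auto simp: ce_def dom_def phi_iff_stage)

text \<open>The use principle: a stage queries the oracle only below its own index.\<close>

lemma stage_cong: "C \<inter> {..<t} = C' \<inter> {..<t} \<Longrightarrow> stage C t = stage C' t"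
proof (induction t)
  case (Suc t)
  then have S: "stage C t = stage C' t" by (force simp: lessThan_Suc)
  have "eval_step C S (pi1 z) (pi1 (pi2 z)) (pi2 (pi2 z)) \<longleftrightarrow>
      eval_step C' S (pi1 z) (pi1 (pi2 z)) (pi2 (pi2 z))" if "z < t" for z S
  proof -
    \<comment> \<open>Only the clause \<open>e = 4\<close> consults the oracle, at the input
      component of \<open>z\<close>.\<close>
    have "pi1 (pi2 z) \<le> z"
      by (metis le_prod_encode_1 le_prod_encode_2 le_trans prod.collapse prod_decode_inverse)
    then have "pi1 (pi2 z) \<in> C \<longleftrightarrow> pi1 (pi2 z) \<in> C'" using Suc.prems that by fastforce
    then show ?thesis by (simp add: eval_step_def)
  qed
  then show ?case by (auto simp: S)
qed simp

section \<open>Stages as a recursive function\<close>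

lemma triple_bounds:
  assumes "triple e x y < t" shows "e < t" "x < t" "y < t"
  using assms le_prod_encode_1[of e "prod_encode (x, y)"] le_prod_encode_2[of "prod_encode (x, y)" e]
    le_prod_encode_1[of x y] le_prod_encode_2[of y x] by linarith+

text \<open>Triples in stage \<open>t\<close> have components below \<open>t\<close>, so the quantifiers can be bounded.\<close>

definition eval_step_below :: "nat \<Rightarrow> nat set \<Rightarrow> nat set \<Rightarrow> nat \<Rightarrow> nat \<Rightarrow> nat \<Rightarrow> bool" where
  "eval_step_below t C S e x y \<longleftrightarrow>
    e = 0 \<and> y = 0 \<or> e = 1 \<and> y = Suc x \<or> e = 2 \<and> y = pi1 x \<or> e = 3 \<and> y = pi2 x \<or>
    e = 4 \<and> y = of_bool (x \<in> C) \<or>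
    (\<exists>p<t. \<exists>q<t. e = 5 + 4 * prod_encode (p, q) \<and> triple p x (pi1 y) \<in> S \<and> triple q x (pi2 y) \<in> S) \<or>
    (\<exists>p<t. \<exists>q<t. e = 6 + 4 * prod_encode (p, q) \<and> (\<exists>a<t. triple q x a \<in> S \<and> triple p a y \<in> S)) \<or>
    (\<exists>p<t. \<exists>q<t. e = 7 + 4 * prod_encode (p, q) \<and>
      (pi2 x = 0 \<and> triple p (pi1 x) y \<in> S \<or>
       pi2 x > 0 \<and> (\<exists>r<t. triple e (prod_encode (pi1 x, pi2 x - 1)) r \<in> S \<and>
         triple q (triple (pi1 x) (pi2 x - 1) r) y \<in> S))) \<or>
    (\<exists>p<t. e = 8 + 4 * p \<and> triple p (prod_encode (x, y)) 0 \<in> S \<and>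
      (\<forall>k<y. \<exists>r<t. r > 0 \<and> triple p (prod_encode (x, k)) r \<in> S))"

lemma eval_step_below_iff:
  assumes "S \<subseteq> {..<t}" "e < t"
  shows "eval_step_below t C S e x y \<longleftrightarrow> eval_step C S e x y"
proof -
  \<comment> \<open>Subprograms are bounded through the code \<open>e\<close> that contains them;
    results and intermediate values are bounded through \<open>S\<close>.\<close>
  have "p < t" "q < t" if "e = n + 4 * prod_encode (p, q)" for n p q
    using that assms(2) le_prod_encode_1[of p q] le_prod_encode_2[of q p] by linarith+
  then have pair: "(\<exists>p q. e = n + 4 * prod_encode (p, q) \<and> Q p q) \<longleftrightarrow>
      (\<exists>p<t. \<exists>q<t. e = n + 4 * prod_encode (p, q) \<and> Q p q)" for n Q by blast
  have "p < t" if "e = 8 + 4 * p" for p using that assms(2) by simp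
  then have mu: "(\<exists>p. e = 8 + 4 * p \<and> Q p) \<longleftrightarrow> (\<exists>p<t. e = 8 + 4 * p \<and> Q p)" for Q by blast
  have z: "z < t" if "triple a b z \<in> S" for a b z
    using that assms(1) by (intro triple_bounds(3)[of a b z]) auto
  then have val: "(\<exists>z. triple a b z \<in> S \<and> Q z) \<longleftrightarrow> (\<exists>z<t. triple a b z \<in> S \<and> Q z)" for a b Q
    by blast
  from z have pos: "(\<exists>z. z > 0 \<and> triple a b z \<in> S) \<longleftrightarrow> (\<exists>z<t. z > 0 \<and> triple a b z \<in> S)" for a b
    by blast
  show ?thesis unfolding eval_step_def eval_step_below_def by (simp only: pair mu val pos)
qed

definition stage_code :: "nat set \<Rightarrow> nat \<Rightarrow> nat" where
  "stage_code C = rec_nat 0 (\<lambda>t r. \<Sum>z<t.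
    of_bool (eval_step_below t C (set_decode r) (pi1 z) (pi1 (pi2 z)) (pi2 (pi2 z))) * 2 ^ z)"

lemma set_decode_stage_code: "set_decode (stage_code C t) = stage C t"
proof (induction t)
  case (Suc t)
  have "stage_code C (Suc t) = set_encode {z. z < t \<and>
      eval_step_below t C (stage C t) (pi1 z) (pi1 (pi2 z)) (pi2 (pi2 z))}"
    by (simp add: set_encode_initial stage_code_def Suc[symmetric])
  moreover have "pi1 z < t" if "z < t" for z
    using that triple_bounds(1)[of "pi1 z" "pi1 (pi2 z)" "pi2 (pi2 z)" t] by simp
  ultimately show ?case
    by (simp add: set_encode_inverse eval_step_below_iff[OF stage_bounded] cong: conj_cong)
qed (simp add: stage_code_def)

text \<open>The simulated oracle \<open>C (f x)\<close> may vary with the argument. This is what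
  allows running programs on the successive approximations of the jump, which are uniformly
  decidable in \<open>A\<close>.\<close>

lemma recursive_in_stage_code:
  assumes C: "decidable_in A (\<lambda>z. pi2 z \<in> C (pi1 z))"
    and f: "recursive_in A f" and g: "recursive_in A g"
  shows "recursive_in A (\<lambda>x. stage_code (C (f x)) (g x))"
proof -
  have C': "recursive_in A u \<Longrightarrow> recursive_in A v \<Longrightarrow> decidable_in A (\<lambda>x. v x \<in> C (u x))" for u v
    using decidable_in_comp[OF C recursive_in_pair[of A u v]] by simp
  show ?thesis
    unfolding stage_code_def eval_step_below_def
    by (intro rec_intros C' g recursive_in_comp[OF f])
qed

lemma decidable_in_stage:
  assumes "decidable_in A (\<lambda>z. pi2 z \<in> C (pi1 z))"
    and "recursive_in A f" "recursive_in A g" "recursive_in A h"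
  shows "decidable_in A (\<lambda>x. h x \<in> stage (C (f x)) (g x))"
  unfolding set_decode_stage_code[symmetric]
  by (intro rec_intros recursive_in_stage_code assms)

lemma decidable_in_stage_oracle [rec_intros]:
  assumes "recursive_in A g" "recursive_in A h"
  shows "decidable_in A (\<lambda>x. h x \<in> stage A (g x))"
  by (intro decidable_in_stage[of A "\<lambda>_. A" "\<lambda>x. x"] assms rec_intros
      decidable_in_comp[OF decidable_in_oracle])

section \<open>Relations enumerable in an oracle\<close>

text \<open>Enumerability as projection of a decidable relation; \<open>ce_in_index\<close> links it
  with \<open>ce\<close>.\<close>

definition ce_in :: "nat set \<Rightarrow> (nat \<Rightarrow> bool) \<Rightarrow> bool" where
  "ce_in A P \<longleftrightarrow> (\<exists>R. decidable_in A (\<lambda>z. R (pi1 z) (pi2 z)) \<and> (\<forall>x. P x \<longleftrightarrow> (\<exists>t. R x t)))"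

named_theorems ce_intros

lemma ex_prod_decode: "(\<exists>z. P (pi1 z) (pi2 z)) \<longleftrightarrow> (\<exists>a b. P a b)"
  by (metis fst_conv prod_encode_inverse snd_conv)

lemma ce_in_decidable:
  assumes "decidable_in A P" shows "ce_in A P"
proof -
  have "decidable_in A (\<lambda>z. P (pi1 z))" by (intro decidable_in_comp[OF assms] rec_intros)
  then show ?thesis unfolding ce_in_def by (intro exI[of _ "\<lambda>x t. P x"]) simp
qed

lemma ce_in_comp:
  assumes "ce_in A P" "recursive_in A f" shows "ce_in A (\<lambda>x. P (f x))"
proof -
  obtain R where R: "decidable_in A (\<lambda>z. R (pi1 z) (pi2 z))" "\<forall>x. P x \<longleftrightarrow> (\<exists>t. R x t)"
    using assms(1) unfolding ce_in_def by blast
  have "decidable_in A (\<lambda>z. R (f (pi1 z)) (pi2 z))"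
    using decidable_in_comp[OF R(1), of "\<lambda>z. prod_encode (f (pi1 z), pi2 z)"]
    by (simp add: rec_intros recursive_in_comp[OF assms(2)])
  with R(2) show ?thesis unfolding ce_in_def by (intro exI[of _ "\<lambda>x. R (f x)"]) simp
qed

lemma ce_in_ex [ce_intros]:
  assumes "ce_in A (\<lambda>z. P (pi1 z) (pi2 z))" shows "ce_in A (\<lambda>x. \<exists>k. P x k)"
proof -
  obtain R where R: "decidable_in A (\<lambda>z. R (pi1 z) (pi2 z))"
    "\<forall>z. P (pi1 z) (pi2 z) \<longleftrightarrow> (\<exists>t. R z t)"
    using assms unfolding ce_in_def by blast
  \<comment> \<open>The two quantifiers merge into one over a pair: the value \<open>k\<close> and
    the witness for it.\<close>
  have "decidable_in A (\<lambda>z. R (prod_encode (pi1 z, pi1 (pi2 z))) (pi2 (pi2 z)))"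
    using decidable_in_comp[OF R(1), of "\<lambda>z. prod_encode (prod_encode (pi1 z, pi1 (pi2 z)), pi2 (pi2 z))"]
    by (simp add: rec_intros)
  moreover have "(\<exists>k. P x k) \<longleftrightarrow> (\<exists>t. R (prod_encode (x, pi1 t)) (pi2 t))" for x
    using ex_prod_decode[of "\<lambda>k t. R (prod_encode (x, k)) t"] R(2)[rule_format, of "prod_encode (x, _)"]
    by simp
  ultimately show ?thesis unfolding ce_in_def
    by (intro exI[of _ "\<lambda>x t. R (prod_encode (x, pi1 t)) (pi2 t)"]) simp
qed

lemma ce_in_conj [ce_intros]:
  assumes "ce_in A P" "ce_in A Q" shows "ce_in A (\<lambda>x. P x \<and> Q x)"
proof -
  obtain R where R: "decidable_in A (\<lambda>z. R (pi1 z) (pi2 z))" "\<forall>x. P x \<longleftrightarrow> (\<exists>t. R x t)"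
    using assms(1) unfolding ce_in_def by blast
  obtain S where S: "decidable_in A (\<lambda>z. S (pi1 z) (pi2 z))" "\<forall>x. Q x \<longleftrightarrow> (\<exists>t. S x t)"
    using assms(2) unfolding ce_in_def by blast
  have "decidable_in A (\<lambda>z. R (pi1 z) (pi1 (pi2 z)) \<and> S (pi1 z) (pi2 (pi2 z)))"
    using decidable_in_conj[OF decidable_in_comp[OF R(1), of "\<lambda>z. prod_encode (pi1 z, pi1 (pi2 z))"]
        decidable_in_comp[OF S(1), of "\<lambda>z. prod_encode (pi1 z, pi2 (pi2 z))"]]
    by (simp add: rec_intros)
  moreover have "P x \<and> Q x \<longleftrightarrow> (\<exists>t. R x (pi1 t) \<and> S x (pi2 t))" for x
    using ex_prod_decode[of "\<lambda>a b. R x a \<and> S x b"] by (simp add: R(2) S(2))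
  ultimately show ?thesis unfolding ce_in_def
    by (intro exI[of _ "\<lambda>x t. R x (pi1 t) \<and> S x (pi2 t)"]) simp
qed

lemma ce_in_disj [ce_intros]:
  assumes "ce_in A P" "ce_in A Q" shows "ce_in A (\<lambda>x. P x \<or> Q x)"
proof -
  obtain R where R: "decidable_in A (\<lambda>z. R (pi1 z) (pi2 z))" "\<forall>x. P x \<longleftrightarrow> (\<exists>t. R x t)"
    using assms(1) unfolding ce_in_def by blast
  obtain S where S: "decidable_in A (\<lambda>z. S (pi1 z) (pi2 z))" "\<forall>x. Q x \<longleftrightarrow> (\<exists>t. S x t)"
    using assms(2) unfolding ce_in_def by blast
  have "decidable_in A (\<lambda>z. R (pi1 z) (pi2 z) \<or> S (pi1 z) (pi2 z))"
    by (intro rec_intros R S)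
  then show ?thesis unfolding ce_in_def using R(2) S(2)
    by (intro exI[of _ "\<lambda>x t. R x t \<or> S x t"]) auto
qed

lemma ce_in_empty: "ce_in {} P \<Longrightarrow> ce_in A P"
  unfolding ce_in_def using decidable_in_empty by blast

lemma ce_in_ce [ce_intros]:
  assumes "recursive_in A f" "recursive_in A g" shows "ce_in A (\<lambda>x. f x \<in> ce A (g x))"
  unfolding ce_iff_stage
  by (intro ce_intros ce_in_decidable rec_intros recursive_in_comp[OF assms(1)]
      recursive_in_comp[OF assms(2)])

lemma ce_in_ce_empty:
  assumes "recursive_in A f" "recursive_in A g" shows "ce_in A (\<lambda>x. f x \<in> ce {} (g x))"
proof -
  have "ce_in A (\<lambda>z. pi1 z \<in> ce {} (pi2 z))" by (rule ce_in_empty) (intro ce_intros rec_intros)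
  from ce_in_comp[OF this recursive_in_pair[OF assms]] show ?thesis by simp
qed

section \<open>Indices of enumerable sets\<close>

lemma ce_in_program:
  assumes "ce_in A P" obtains p where "dom (eval A p) = {x. P x}"
proof -
  obtain R where R: "decidable_in A (\<lambda>z. R (pi1 z) (pi2 z))" "\<forall>x. P x \<longleftrightarrow> (\<exists>t. R x t)"
    using assms unfolding ce_in_def by blast
  \<comment> \<open>\<open>Mu\<close> searches for a zero, so it is applied to the negation. The
    tested function is total, hence the search halts exactly when a witness exists.\<close>
  have "decidable_in A (\<lambda>z. \<not> R (pi1 z) (pi2 z))" by (intro rec_intros R)
  then obtain p where "\<forall>z. eval A p z = Some (of_bool (\<not> R (pi1 z) (pi2 z)))"
    unfolding decidable_in_def recursive_in_def by blast
  then have "dom (eval A (Mu p)) = {x. P x}"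
    using R(2) by (auto simp: dom_def of_bool_def)
  then show ?thesis by (rule that)
qed

lemma ce_in_index:
  assumes "ce_in A P" obtains e where "ce A e = {x. P x}"
  using ce_in_program[OF assms] by (metis ce_def phi_code)

primrec const_prog :: "nat \<Rightarrow> prog" where
  "const_prog 0 = Zero"
| "const_prog (Suc n) = Cmp Succ (const_prog n)"

lemma eval_const_prog: "eval A (const_prog n) x = Some n"
  by (induction n) simp_all

text \<open>The s-m-n theorem.\<close>

lemma ce_in_uniform_index:
  assumes "ce_in A (\<lambda>z. P (pi1 z) (pi2 z))"
  obtains f where "recursive_in {} f" "\<And>i. ce A (f i) = {x. P i x}"
proof -
  obtain p where p: "dom (eval A p) = {z. P (pi1 z) (pi2 z)}" using ce_in_program[OF assms] .
  \<comment> \<open>The program pairs the constant \<open>i\<close> with its input,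
    \<open>Tup Fst Snd\<close> being the identity, and then runs \<open>p\<close>.\<close>
  define f where "f i = code (Cmp p (Tup (const_prog i) (Tup Fst Snd)))" for i
  \<comment> \<open>\<open>6 + 4 * prod_encode (1, r)\<close> is the code of \<open>Cmp Succ\<close>
    applied to the program with code \<open>r\<close>. Thus \<open>f\<close> is recursive without
    oracle even when \<open>p\<close> queries one.\<close>
  have const: "code (const_prog i) = rec_nat 0 (\<lambda>k r. 6 + 4 * prod_encode (1, r)) i" for i
    by (induction i) simp_all
  have "recursive_in {} f"
    unfolding f_def code.simps const by (intro rec_intros)
  moreover have "ce A (f i) = {x. P i x}" for i
  proof -
    have "x \<in> ce A (f i) \<longleftrightarrow> prod_encode (i, x) \<in> dom (eval A p)" for x
      by (simp add: ce_def f_def eval_const_prog dom_def del: code.simps)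
    then show ?thesis using p by auto
  qed
  ultimately show ?thesis by (rule that)
qed

section \<open>Enumerability in the jump\<close>

text \<open>An increasing, uniformly decidable approximation of the jump. The bound on
  \<open>y\<close> makes it decidable and loses nothing, as every triple of stage \<open>t\<close>
  lies below \<open>t\<close>.\<close>

definition jump_stage :: "nat set \<Rightarrow> nat \<Rightarrow> nat set" where
  "jump_stage A t = {e. \<exists>y<t. triple e e y \<in> stage A t}"

lemma jump_stage_mono: "t \<le> t' \<Longrightarrow> jump_stage A t \<subseteq> jump_stage A t'"
  unfolding jump_stage_def using stage_mono[of t t' A] less_le_trans[of _ t t'] by blast

lemma jump_eq_Union_stages: "jump A = (\<Union>t. jump_stage A t)"
proof -
  have "\<exists>y<t. triple e e y \<in> stage A t" if "triple e e y \<in> stage A t" for e y t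
    using that stage_bounded[of A t] triple_bounds(3)[of e e y t] by auto
  then show ?thesis by (simp add: set_eq_iff jump_def jump_stage_def ce_iff_stage) blast
qed

text \<open>An element never leaves the approximation once it has entered; finitely many elements
  have a common entry time.\<close>

lemma jump_stage_stabilises: "\<exists>t0. \<forall>t\<ge>t0. jump_stage A t \<inter> {..<m} = jump A \<inter> {..<m}"
proof -
  have "\<exists>t0. \<forall>e<m. e \<in> jump A \<longrightarrow> e \<in> jump_stage A t0"
  proof (induction m)
    case (Suc m)
    then obtain t0 where t0: "\<forall>e<m. e \<in> jump A \<longrightarrow> e \<in> jump_stage A t0" by blast
    obtain t1 where t1: "m \<in> jump A \<longrightarrow> m \<in> jump_stage A t1"
      by (auto simp: jump_eq_Union_stages)
    have "\<forall>e<Suc m. e \<in> jump A \<longrightarrow> e \<in> jump_stage A (max t0 t1)"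
      using t0 t1 jump_stage_mono[of t0 "max t0 t1" A] jump_stage_mono[of t1 "max t0 t1" A]
      by (auto simp: less_Suc_eq)
    then show ?case ..
  qed simp
  then obtain t0 where "\<forall>e<m. e \<in> jump A \<longrightarrow> e \<in> jump_stage A t0" ..
  then have "jump_stage A t \<inter> {..<m} = jump A \<inter> {..<m}" if "t \<ge> t0" for t
    using jump_stage_mono[OF that, of A] by (auto simp: jump_eq_Union_stages)
  then show ?thesis by blast
qed

text \<open>By the use principle stage \<open>t\<close> sees the jump only below \<open>t\<close>,
  where the approximation is eventually correct. Membership at all late \<open>u\<close> is
  therefore membership in the limit.\<close>

lemma stage_jump_limit:
  "z \<in> stage (jump A) t \<longleftrightarrow> (\<exists>u0. \<forall>u\<ge>u0. z \<in> stage (jump_stage A u) t)" (is "_ \<longleftrightarrow> ?R")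
proof -
  obtain t0 where t0: "\<And>u. u \<ge> t0 \<Longrightarrow> stage (jump_stage A u) t = stage (jump A) t"
    using jump_stage_stabilises[of A t] stage_cong by metis
  show ?thesis
  proof
    assume ?R
    then obtain u0 where "\<forall>u\<ge>u0. z \<in> stage (jump_stage A u) t" ..
    then show "z \<in> stage (jump A) t" using t0[of "max t0 u0"] by auto
  qed (use t0 in blast)
qed

lemma ce_jump_Sigma2:
  obtains R where "ce_in A R" "\<And>e x. x \<in> ce (jump A) e \<longleftrightarrow> (\<exists>w. \<not> R (triple e x w))"
proof -
  have J: "decidable_in A (\<lambda>z. pi2 z \<in> jump_stage A (pi1 z))"
    unfolding jump_stage_def mem_Collect_eq by (intro rec_intros)
  \<comment> \<open>The witness \<open>w\<close> packs a stage \<open>t\<close>, an output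
    \<open>y\<close> and a threshold \<open>u0\<close>; \<open>R\<close> says that some later
    approximation refutes it.\<close>
  define R where "R z \<longleftrightarrow> (\<exists>u. u \<ge> pi2 (pi2 (pi2 (pi2 z))) \<and>
      triple (pi1 z) (pi1 (pi2 z)) (pi1 (pi2 (pi2 (pi2 z)))) \<notin>
      stage (jump_stage A u) (pi1 (pi2 (pi2 z))))" for z
  have "ce_in A R"
    unfolding R_def by (intro ce_intros ce_in_decidable rec_intros decidable_in_stage[OF J])
  moreover have "x \<in> ce (jump A) e \<longleftrightarrow> (\<exists>w. \<not> R (triple e x w))" for e x
  proof -
    have "x \<in> ce (jump A) e \<longleftrightarrow> (\<exists>t y u0. \<forall>u\<ge>u0. triple e x y \<in> stage (jump_stage A u) t)"
      by (simp add: ce_iff_stage stage_jump_limit)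
    also have "\<dots> \<longleftrightarrow> (\<exists>t y u0. \<not> R (triple e x (triple t y u0)))"
      by (simp add: R_def)
    also have "\<dots> \<longleftrightarrow> (\<exists>w. \<not> R (triple e x w))"
      by (metis prod.collapse prod_decode_inverse)
    finally show ?thesis .
  qed
  ultimately show ?thesis by (rule that)
qed

section \<open>Metric spaces and the effective Borel hierarchy\<close>

lemma enum_pos_rat_pos: "enum_pos_rat k > 0"
  by (simp add: enum_pos_rat_def case_prod_beta)

lemma enum_pos_rat_dense:
  assumes "0 \<le> x" "x < y" obtains k where "x < enum_pos_rat k" "enum_pos_rat k < y"
proof -
  obtain q where q: "q \<in> \<rat>" "x < q" "q < y" using Rats_dense_in_real[OF assms(2)] by blast
  obtain a b :: nat where ab: "b \<noteq> 0" "\<bar>q\<bar> = real a / real b" using Rats_abs_nat_div_natE[OF q(1)] .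
  have "a \<noteq> 0" using ab q(2) assms(1) by (intro notI) auto
  have "enum_pos_rat (prod_encode (a - 1, b - 1)) = q"
    using ab \<open>a \<noteq> 0\<close> q(2) assms(1) by (simp add: enum_pos_rat_def del: of_nat_Suc)
  with q that show thesis by metis
qed

text \<open>Clearing denominators leaves decidable arithmetic on naturals. Odd codes under
  \<open>int_decode\<close> stand for negative integers, so only even \<open>pi1 j\<close> can
  exceed the positive bound.\<close>

lemma enum_rat_greater_iff:
  "enum_rat j > enum_pos_rat k + enum_pos_rat b + 1 / 2 ^ m \<longleftrightarrow>
    2 * (pi1 j div 2) = pi1 j \<and>
    Suc (pi2 j) * (Suc (pi1 k) * Suc (pi2 b) * 2 ^ m + Suc (pi1 b) * Suc (pi2 k) * 2 ^ m
      + Suc (pi2 k) * Suc (pi2 b))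
    < pi1 j div 2 * Suc (pi2 k) * Suc (pi2 b) * 2 ^ m" (is "?L \<longleftrightarrow> ?E \<and> ?R")
proof -
  have pos: "0 < enum_pos_rat k + enum_pos_rat b + 1 / 2 ^ m"
    using enum_pos_rat_pos[of k] enum_pos_rat_pos[of b] by (simp add: add_pos_pos)
  have frac: "u / n > a / c + a' / c' + 1 / M \<longleftrightarrow> n * (a * c' * M + a' * c * M + c * c') < u * c * c' * M"
    if "n > 0" "c > 0" "c' > 0" "M > 0" for u n a c a' c' M :: real
  proof -
    have "a / c + a' / c' + 1 / M = (a * c' * M + a' * c * M + c * c') / (c * c' * M)"
      using that by (simp add: field_simps)
    then show ?thesis using that by (simp add: field_simps)
  qed
  show ?thesis
  proof (cases "even (pi1 j)")
    case True
    then have "enum_rat j = real (pi1 j div 2) / real (Suc (pi2 j))"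
      by (simp add: enum_rat_def case_prod_beta int_decode_def sum_decode_def)
    then have "?L \<longleftrightarrow> real (pi1 j div 2) / real (Suc (pi2 j)) >
        real (Suc (pi1 k)) / real (Suc (pi2 k)) + real (Suc (pi1 b)) / real (Suc (pi2 b)) + 1 / 2 ^ m"
      by (simp only: enum_pos_rat_def case_prod_beta)
    also have "\<dots> \<longleftrightarrow> real (Suc (pi2 j) * (Suc (pi1 k) * Suc (pi2 b) * 2 ^ m + Suc (pi1 b) * Suc (pi2 k) * 2 ^ m
      + Suc (pi2 k) * Suc (pi2 b))) < real (pi1 j div 2 * Suc (pi2 k) * Suc (pi2 b) * 2 ^ m)"
      by (subst frac) (simp_all only: of_nat_mult of_nat_add of_nat_power of_nat_numeral
          of_nat_0_less_iff zero_less_Suc zero_less_power zero_less_numeral)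
    also have "\<dots> \<longleftrightarrow> ?R" by (rule of_nat_less_iff)
    finally show ?thesis using True by simp
  next
    case False
    then have "enum_rat j \<le> 0"
      by (simp add: enum_rat_def case_prod_beta int_decode_def sum_decode_def divide_le_0_iff)
    moreover have "\<not> ?E" using False by presburger
    ultimately show ?thesis using pos by auto
  qed
qed

lemma decidable_in_enum_pos_rat_less [rec_intros]:
  assumes "recursive_in A f" "recursive_in A g"
  shows "decidable_in A (\<lambda>x. enum_pos_rat (f x) < enum_pos_rat (g x))"
proof -
  have "enum_pos_rat a < enum_pos_rat b \<longleftrightarrow>
      Suc (pi1 a) * Suc (pi2 b) < Suc (pi1 b) * Suc (pi2 a)" for a b
  proof -
    have "enum_pos_rat a < enum_pos_rat b \<longleftrightarrow>
        real (Suc (pi1 a)) * real (Suc (pi2 b)) < real (Suc (pi1 b)) * real (Suc (pi2 a))"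
      unfolding enum_pos_rat_def case_prod_beta by (simp add: frac_less_eq field_simps del: of_nat_Suc)
    then show ?thesis by (simp only: of_nat_mult[symmetric] of_nat_less_iff)
  qed
  then show ?thesis by (simp only:) (intro rec_intros assms)
qed

text \<open>A strict lower bound on a computable real is confirmed by an approximation that exceeds
  it by more than its own error.\<close>

lemma ce_in_dist_greater:
  assumes "computable_metric_space s"
  shows "ce_in A (\<lambda>z. enum_pos_rat (pi1 (pi2 z)) + enum_pos_rat (pi2 (pi2 z)) <
    dist (s (pi1 (pi1 z))) (s (pi2 (pi1 z))))"
proof -
  obtain f where f: "computable f"
    and "\<And>ij. case prod_decode ij of (i, j) \<Rightarrow> computable_real_index (f ij) (dist (s i) (s j))"
    using assms unfolding computable_metric_space_def uniformly_def by blast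
  then have approx: "\<exists>j. phi {} (f ij) m = Some j \<and>
      \<bar>enum_rat j - dist (s (pi1 ij)) (s (pi2 ij))\<bar> \<le> 1 / 2 ^ m" for ij m
    by (simp add: case_prod_beta computable_real_index_def)
  have "enum_pos_rat k + enum_pos_rat b < dist (s (pi1 ij)) (s (pi2 ij)) \<longleftrightarrow>
      (\<exists>m j t. triple (f ij) m j \<in> stage {} t \<and>
        enum_rat j > enum_pos_rat k + enum_pos_rat b + 1 / 2 ^ m)" (is "?L \<longleftrightarrow> ?R") for k b ij
  proof
    assume ?L
    \<comment> \<open>Half the gap: the precision is spent once on the error of
      \<open>enum_rat j\<close> and once on the required margin.\<close>
    then obtain m where "(1 / 2) ^ m < (dist (s (pi1 ij)) (s (pi2 ij)) - (enum_pos_rat k + enum_pos_rat b)) / 2"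
      using real_arch_pow_inv[of "(dist (s (pi1 ij)) (s (pi2 ij)) - (enum_pos_rat k + enum_pos_rat b)) / 2" "1 / 2"]
      by auto
    moreover obtain j where j: "phi {} (f ij) m = Some j"
      "\<bar>enum_rat j - dist (s (pi1 ij)) (s (pi2 ij))\<bar> \<le> 1 / 2 ^ m" using approx by blast
    ultimately have "enum_rat j > enum_pos_rat k + enum_pos_rat b + 1 / 2 ^ m"
      by (simp add: power_one_over)
    then show ?R using j(1) phi_iff_stage by blast
  next
    assume ?R
    then obtain m j t where t: "triple (f ij) m j \<in> stage {} t"
      and j: "enum_rat j > enum_pos_rat k + enum_pos_rat b + 1 / 2 ^ m" by blast
    have "phi {} (f ij) m = Some j" using t phi_iff_stage by blast
    with approx[of ij m] have "\<bar>enum_rat j - dist (s (pi1 ij)) (s (pi2 ij))\<bar> \<le> 1 / 2 ^ m" by auto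
    with j show ?L by linarith
  qed
  moreover have "ce_in A (\<lambda>z. \<exists>m j t. triple (f (pi1 z)) m j \<in> stage {} t \<and>
      enum_rat j > enum_pos_rat (pi1 (pi2 z)) + enum_pos_rat (pi2 (pi2 z)) + 1 / 2 ^ m)"
    unfolding enum_rat_greater_iff
    by (rule ce_in_empty)
      (intro ce_intros ce_in_decidable rec_intros recursive_in_comp[OF recursive_in_computable[OF f]])
  ultimately show ?thesis by simp
qed

section \<open>Open balls, closed balls and their complements\<close>

lemma ideal_ball_iff: "x \<in> ideal_ball s m \<longleftrightarrow> dist x (s (pi1 m)) < enum_pos_rat (pi2 m)"
  by (simp add: ideal_ball_def case_prod_beta)

lemma open_ideal_ball: "open (ideal_ball s m)"
proof -
  have "ideal_ball s m = ball (s (pi1 m)) (enum_pos_rat (pi2 m))"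
    by (auto simp: ideal_ball_iff dist_commute)
  then show ?thesis by simp
qed

text \<open>Closed balls have effectively open complements, so this exhibits an ideal ball as a
  Sigma^0_2 set. A radius fits strictly between the distance of the point and that of the ball by
  density.\<close>

lemma ideal_ball_eq_Union_closed:
  "ideal_ball s m = (\<Union>k\<in>{k. enum_pos_rat k < enum_pos_rat (pi2 m)}. {x. dist x (s (pi1 m)) \<le> enum_pos_rat k})"
proof -
  have "\<exists>k. enum_pos_rat k < enum_pos_rat (pi2 m) \<and> d \<le> enum_pos_rat k"
    if "d < enum_pos_rat (pi2 m)" "0 \<le> d" for d
    using enum_pos_rat_dense[OF that(2,1)] by (metis less_imp_le)
  then show ?thesis by (auto simp: ideal_ball_iff intro: le_less_trans)
qed

lemma obtain_near_point:
  assumes "computable_metric_space s" "e > 0"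
  obtains b where "x \<in> ideal_ball s b" "enum_pos_rat (pi2 b) < e"
proof -
  obtain k where k: "enum_pos_rat k < e" using enum_pos_rat_dense[OF order_refl assms(2)] by blast
  have "x \<in> closure (range s)" using assms(1) by (simp add: computable_metric_space_def)
  then obtain i where "dist (s i) x < enum_pos_rat k"
    using enum_pos_rat_pos[of k] by (auto simp: closure_approachable)
  with k that[of "prod_encode (i, k)"] show thesis by (simp add: ideal_ball_iff dist_commute)
qed

text \<open>The condition on \<open>b\<close> is enumerable by \<open>ce_in_dist_greater\<close>, so
  the exterior of a closed ball is Sigma^0_1, uniformly.\<close>

lemma exterior_eq_Union_balls:
  assumes "computable_metric_space s"
  shows "{x. enum_pos_rat k < dist x (s i)} =
    (\<Union>b\<in>{b. enum_pos_rat k + enum_pos_rat (pi2 b) < dist (s (pi1 b)) (s i)}. ideal_ball s b)"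
    (is "?L = ?R")
proof
  show "?L \<subseteq> ?R"
  proof
    fix x assume "x \<in> ?L"
    \<comment> \<open>Half the gap: the radius of \<open>b\<close> bounds the distance of
      \<open>x\<close> to the centre and is added once more in the condition on
      \<open>b\<close>.\<close>
    then obtain b where b: "x \<in> ideal_ball s b" "enum_pos_rat (pi2 b) < (dist x (s i) - enum_pos_rat k) / 2"
      using obtain_near_point[OF assms, of "(dist x (s i) - enum_pos_rat k) / 2" x] by auto
    have "dist x (s i) \<le> dist x (s (pi1 b)) + dist (s (pi1 b)) (s i)" by (rule dist_triangle)
    with b have "enum_pos_rat k + enum_pos_rat (pi2 b) < dist (s (pi1 b)) (s i)"
      by (simp add: ideal_ball_iff)
    with b(1) show "x \<in> ?R" by blast
  qed
  show "?R \<subseteq> ?L"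
  proof
    fix x assume "x \<in> ?R"
    then obtain b where b: "enum_pos_rat k + enum_pos_rat (pi2 b) < dist (s (pi1 b)) (s i)"
      "dist x (s (pi1 b)) < enum_pos_rat (pi2 b)" by (auto simp: ideal_ball_iff)
    have "dist (s (pi1 b)) (s i) \<le> dist x (s (pi1 b)) + dist x (s i)"
      by (metis dist_triangle3)
    with b show "x \<in> ?L" by simp
  qed
qed

section \<open>Raising the level of the hierarchy to remove jumps\<close>

lemma Sigma_set_UNIV:
  assumes "computable_metric_space s" "ce A e = UNIV"
  shows "Sigma_set s A (Suc m) e = UNIV"
proof (cases m)
  case 0
  have "x \<in> (\<Union>i. ideal_ball s i)" for x
    using obtain_near_point[OF assms(1) zero_less_one, of x] by blast
  then show ?thesis using assms(2) 0 by auto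
next
  case (Suc m')
  \<comment> \<open>Among all indices is one of the empty set, whose complement is already the whole
    space.\<close>
  have "ce_in A (\<lambda>x. False)" by (intro ce_in_decidable rec_intros)
  then obtain e' where "ce A e' = {x. False}" by (rule ce_in_index)
  then have "Sigma_set s A (Suc m') e' = {}" by (cases m') auto
  then show ?thesis using assms(2) Suc by auto
qed

lemma Sigma_set_Union_complements:
  assumes "recursive_in {} h"
  obtains f where "recursive_in {} f"
    "\<And>e. Sigma_set s A (Suc (Suc m)) (f e) = (\<Union>v. - Sigma_set s A (Suc m) (h (prod_encode (e, v))))"
proof -
  have "ce_in A (\<lambda>z. \<exists>v. pi2 z = h (prod_encode (pi1 z, v)))"
    by (intro ce_intros ce_in_decidable rec_intros recursive_in_comp[OF recursive_in_empty[OF assms]])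
  then obtain f where f: "recursive_in {} f" "\<And>e. ce A (f e) = {j. \<exists>v. j = h (prod_encode (e, v))}"
    by (rule ce_in_uniform_index) blast
  show thesis by (rule that[OF f(1)]) (auto simp: f(2))
qed

text \<open>
  The membership condition \<open>\<exists>w. \<not> R\<close> from \<open>ce_jump_Sigma2\<close> is absorbed into the sets: where \<open>R\<close>
  holds, the set is enlarged to the whole space, so that its complement contributes nothing.
\<close>

lemma Sigma_set_jump:
  assumes s: "computable_metric_space s"
  shows "\<exists>f. recursive_in {} f \<and>
    (\<forall>e. Sigma_set s (jump A) (Suc m) e = Sigma_set s A (Suc (Suc m)) (f e))"
proof (induction m)
  case 0
  obtain R where R: "ce_in A R" "\<And>e x. x \<in> ce (jump A) e \<longleftrightarrow> (\<exists>w. \<not> R (triple e x w))"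
    by (rule ce_jump_Sigma2) blast
  \<comment> \<open>The combination is discarded if \<open>w\<close> fails to witness that ball
    \<open>i\<close> is enumerated, or if the closed ball of radius \<open>k\<close> need not lie
    inside ball \<open>i\<close>.\<close>
  define N where "N e i w k \<longleftrightarrow> R (triple e i w) \<or> \<not> enum_pos_rat k < enum_pos_rat (pi2 i)" for e i w k
  \<comment> \<open>Here \<open>pi1 z\<close> codes \<open>(e, triple i w k)\<close> and
    \<open>pi2 z\<close> is a ball, enumerated if the combination is discarded or if the ball
    certifies part of the exterior of the closed ball.\<close>
  have "ce_in A (\<lambda>z. N (pi1 (pi1 z)) (pi1 (pi2 (pi1 z))) (pi1 (pi2 (pi2 (pi1 z)))) (pi2 (pi2 (pi2 (pi1 z)))) \<or>
      enum_pos_rat (pi2 (pi2 (pi2 (pi1 z)))) + enum_pos_rat (pi2 (pi2 z)) <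
        dist (s (pi1 (pi2 z))) (s (pi1 (pi1 (pi2 (pi1 z))))))" (is "ce_in A (\<lambda>z. ?P (pi1 z) (pi2 z))")
  proof -
    have D: "ce_in A (\<lambda>z. enum_pos_rat (k z) + enum_pos_rat (b z) < dist (s (i z)) (s (j z)))"
      if "recursive_in A k" "recursive_in A b" "recursive_in A i" "recursive_in A j" for k b i j
      using ce_in_comp[OF ce_in_dist_greater[OF s],
          of A "\<lambda>z. prod_encode (prod_encode (i z, j z), prod_encode (k z, b z))"] that
      by (simp add: rec_intros)
    have E: "ce_in A (\<lambda>z. \<not> enum_pos_rat (k z) < enum_pos_rat (b z))"
      if "recursive_in A k" "recursive_in A b" for k b
      by (intro ce_in_decidable rec_intros that)
    show ?thesis
      unfolding N_def by (intro ce_intros ce_in_comp[OF R(1)] D E rec_intros)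
  qed
  then obtain h where h: "recursive_in {} h" "\<And>z. ce A (h z) = {b. ?P z b}"
    by (rule ce_in_uniform_index) blast
  have hset: "Sigma_set s A (Suc 0) (h (prod_encode (e, triple i w k))) =
      (if N e i w k then UNIV else {x. enum_pos_rat k < dist x (s (pi1 i))})" for e i w k
  proof (cases "N e i w k")
    case True
    then have "ce A (h (prod_encode (e, triple i w k))) = UNIV" by (simp add: h)
    then show ?thesis using True Sigma_set_UNIV[OF s] by metis
  next
    case False
    then show ?thesis by (simp add: h exterior_eq_Union_balls[OF s])
  qed
  obtain f where f: "recursive_in {} f" "\<And>e. Sigma_set s A (Suc (Suc 0)) (f e) =
      (\<Union>v. - Sigma_set s A (Suc 0) (h (prod_encode (e, v))))"
    using Sigma_set_Union_complements[OF h(1)] by blast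
  have "Sigma_set s (jump A) (Suc 0) e = Sigma_set s A (Suc (Suc 0)) (f e)" for e
  proof (rule set_eqI)
    fix x
    have "x \<in> Sigma_set s (jump A) (Suc 0) e \<longleftrightarrow> (\<exists>i. i \<in> ce (jump A) e \<and>
        (\<exists>k. enum_pos_rat k < enum_pos_rat (pi2 i) \<and> dist x (s (pi1 i)) \<le> enum_pos_rat k))"
      by (simp add: ideal_ball_eq_Union_closed Bex_def)
    also have "\<dots> \<longleftrightarrow> (\<exists>i w k. \<not> N e i w k \<and> \<not> enum_pos_rat k < dist x (s (pi1 i)))"
      unfolding R(2) N_def by (auto simp: not_less not_le)
    also have "\<dots> \<longleftrightarrow> (\<exists>i w k. x \<notin> Sigma_set s A (Suc 0) (h (prod_encode (e, triple i w k))))"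
      unfolding hset by auto
    also have "\<dots> \<longleftrightarrow> (\<exists>v. x \<notin> Sigma_set s A (Suc 0) (h (prod_encode (e, v))))"
      by (metis prod.collapse prod_decode_inverse)
    finally show "x \<in> Sigma_set s (jump A) (Suc 0) e \<longleftrightarrow> x \<in> Sigma_set s A (Suc (Suc 0)) (f e)"
      unfolding f(2) by blast
  qed
  with f(1) show ?case by blast
next
  case (Suc m)
  then obtain g where g: "recursive_in {} g"
    "\<And>e. Sigma_set s (jump A) (Suc m) e = Sigma_set s A (Suc (Suc m)) (g e)" by blast
  obtain R where R: "ce_in A R" "\<And>e x. x \<in> ce (jump A) e \<longleftrightarrow> (\<exists>w. \<not> R (triple e x w))"
    by (rule ce_jump_Sigma2) blast
  have "ce_in A (\<lambda>z. R (pi1 z) \<or> pi2 z \<in> ce A (g (pi1 (pi2 (pi1 z)))))"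
    by (intro ce_intros ce_in_comp[OF R(1)] rec_intros recursive_in_comp[OF recursive_in_empty[OF g(1)]])
  then obtain h where h: "recursive_in {} h" "\<And>z. ce A (h z) = {b. R z \<or> b \<in> ce A (g (pi1 (pi2 z)))}"
    by (rule ce_in_uniform_index) blast
  have hset: "Sigma_set s A (Suc (Suc m)) (h (triple e i w)) =
      (if R (triple e i w) then UNIV else Sigma_set s A (Suc (Suc m)) (g i))" for e i w
  proof (cases "R (triple e i w)")
    case True
    then have "ce A (h (triple e i w)) = UNIV" by (simp add: h)
    then show ?thesis using True Sigma_set_UNIV[OF s] by metis
  next
    case False
    then show ?thesis by (simp add: h)
  qed
  obtain f where f: "recursive_in {} f" "\<And>e. Sigma_set s A (Suc (Suc (Suc m))) (f e) =
      (\<Union>v. - Sigma_set s A (Suc (Suc m)) (h (prod_encode (e, v))))"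
    using Sigma_set_Union_complements[OF h(1)] by blast
  have "Sigma_set s (jump A) (Suc (Suc m)) e = Sigma_set s A (Suc (Suc (Suc m))) (f e)" for e
  proof (rule set_eqI)
    fix x
    have "x \<in> Sigma_set s (jump A) (Suc (Suc m)) e \<longleftrightarrow>
        (\<exists>i w. \<not> R (triple e i w) \<and> x \<notin> Sigma_set s A (Suc (Suc m)) (g i))"
      unfolding Sigma_set.simps(3)[of s "jump A"] g(2) UN_iff Compl_iff Bex_def R(2) by blast
    also have "\<dots> \<longleftrightarrow> (\<exists>i w. x \<notin> Sigma_set s A (Suc (Suc m)) (h (triple e i w)))"
      unfolding hset by auto
    also have "\<dots> \<longleftrightarrow> (\<exists>v. x \<notin> Sigma_set s A (Suc (Suc m)) (h (prod_encode (e, v))))"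
      by (metis prod.collapse prod_decode_inverse)
    finally show "x \<in> Sigma_set s (jump A) (Suc (Suc m)) e \<longleftrightarrow> x \<in> Sigma_set s A (Suc (Suc (Suc m))) (f e)"
      unfolding f(2) by blast
  qed
  with f(1) show ?case by blast
qed

lemma is_Sigma_iterated_jump:
  assumes "computable_metric_space s"
  shows "is_Sigma s ((jump ^^ j) A) (Suc m) U \<Longrightarrow> is_Sigma s A (Suc m + j) U"
proof (induction j arbitrary: A m)
  case (Suc j)
  \<comment> \<open>The innermost jump is set aside: the induction hypothesis over
    \<open>jump A\<close> removes the outer \<open>j\<close> jumps, and
    \<open>Sigma_set_jump\<close> removes the last one.\<close>
  have "is_Sigma s ((jump ^^ j) (jump A)) (Suc m) U" using Suc.prems by (simp add: funpow_swap1)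
  then have "is_Sigma s (jump A) (Suc (m + j)) U" using Suc.IH[of "jump A" m] by simp
  then have "is_Sigma s A (Suc (Suc (m + j))) U"
    unfolding is_Sigma_def using Sigma_set_jump[OF assms, of A "m + j"] by metis
  then show ?case by simp
qed simp

section \<open>Recurrence\<close>

lemma iterate_0 [simp]: "iterate T 0 x = Some x"
  by (simp add: iterate_def)

lemma iterate_Suc: "iterate T (Suc k) x = Option.bind (iterate T k x) T"
  by (simp add: iterate_def)

lemma iterate_Suc': "T x = Some y \<Longrightarrow> iterate T (Suc k) x = iterate T k y"
  by (induction k) (simp_all add: iterate_def)

text \<open>Time 0 is defined at every point, also outside \<open>dom T\<close>; the restriction to
  \<open>dom T\<close> makes all iterates defined when
  \<open>ran T \<subseteq> dom T\<close>.\<close>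

definition visits :: "('a \<rightharpoonup> 'a) \<Rightarrow> 'a set \<Rightarrow> nat \<Rightarrow> 'a set" where
  "visits T Q m = {x \<in> dom T. \<exists>k\<ge>m. \<exists>y\<in>Q. iterate T k x = Some y}"

lemma visits_subset_dom: "visits T Q m \<subseteq> dom T"
  by (auto simp: visits_def)

lemma ex_Suc_le_iff: "(\<exists>k\<ge>Suc m. R k) \<longleftrightarrow> (\<exists>k\<ge>m. R (Suc k))"
  by (metis Suc_le_D Suc_le_mono)

lemma visits_Suc_0_iff:
  "x \<in> dom T \<Longrightarrow> x \<in> visits T Q (Suc 0) \<longleftrightarrow> (\<exists>k. \<exists>y\<in>Q. iterate T (Suc k) x = Some y)"
  by (simp add: visits_def ex_Suc_le_iff)

text \<open>One application of \<open>T\<close> shifts all visiting times by one, and invariance of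
  the domain keeps the image point eligible.\<close>

lemma preimage_visits:
  assumes "ran T \<subseteq> dom T" shows "preimage T (visits T Q m) = visits T Q (Suc m)"
proof (rule set_eqI)
  fix x
  show "x \<in> preimage T (visits T Q m) \<longleftrightarrow> x \<in> visits T Q (Suc m)"
  proof (cases "T x")
    case (Some y)
    have "y \<in> dom T" using assms Some by (auto simp: ran_def)
    then have "x \<in> preimage T (visits T Q m) \<longleftrightarrow> (\<exists>k\<ge>m. \<exists>z\<in>Q. iterate T (Suc k) x = Some z)"
      by (simp add: preimage_def visits_def Some iterate_Suc'[of T x y, OF Some])
    also have "\<dots> \<longleftrightarrow> (\<exists>k\<ge>Suc m. \<exists>z\<in>Q. iterate T k x = Some z)"
      by (simp add: ex_Suc_le_iff)
    finally show ?thesis using Some by (auto simp: visits_def)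
  qed (auto simp: preimage_def visits_def)
qed

lemma preimage_INT: "preimage T (\<Inter>m. F m) = (\<Inter>m. preimage T (F m))"
proof (rule set_eqI)
  fix x
  show "x \<in> preimage T (\<Inter>m. F m) \<longleftrightarrow> x \<in> (\<Inter>m. preimage T (F m))"
    by (cases "T x") (auto simp: preimage_def)
qed

lemma visits_borel:
  assumes "measure_preserving \<mu> T" and Q: "Q \<in> sets borel"
  shows "visits T Q m \<in> sets borel"
proof -
  have pre: "B \<in> sets borel \<Longrightarrow> preimage T B \<in> sets borel" for B
    using assms(1) by (simp add: measure_preserving_def)
  have dom: "dom T \<in> sets borel" using pre[of UNIV] by (simp add: preimage_def dom_def)
  have "{x \<in> dom T. \<exists>y\<in>Q. iterate T k x = Some y} \<in> sets borel" for k
  proof (induction k)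
    case 0
    have "{x \<in> dom T. \<exists>y\<in>Q. iterate T 0 x = Some y} = dom T \<inter> Q" by auto
    then show ?case using dom Q by simp
  next
    case (Suc k)
    have "{x \<in> dom T. \<exists>y\<in>Q. iterate T (Suc k) x = Some y} =
        preimage T {x \<in> dom T. \<exists>y\<in>Q. iterate T k x = Some y}"
      using assms(1) by (force simp: preimage_def iterate_Suc' measure_preserving_def ran_def)
    then show ?case using pre[OF Suc] by simp
  qed
  moreover have "visits T Q m = (\<Union>k\<in>{m..}. {x \<in> dom T. \<exists>y\<in>Q. iterate T k x = Some y})"
    by (auto simp: visits_def)
  ultimately show ?thesis by (simp add: sets.countable_UN)
qed

text \<open>
  Points that visit \<open>Q\<close> infinitely often form a strictly invariant set, of the same measure as the
  points that visit \<open>Q\<close> at some time \<open>k \<ge> 0\<close>.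
\<close>

lemma measure_visits:
  assumes "prob_space \<mu>" and sets: "sets \<mu> = sets borel"
    and T: "measure_preserving \<mu> T" and erg: "ergodic \<mu> T"
    and Q: "Q \<in> sets borel" "measure \<mu> Q > 0"
  shows "measure \<mu> (visits T Q m) = 1"
proof -
  interpret prob_space \<mu> by fact
  have ran: "ran T \<subseteq> dom T" using T by (simp add: measure_preserving_def)
  have borel: "visits T Q m \<in> sets borel" for m using visits_borel[OF T Q(1)] .
  have dec: "decseq (visits T Q)" by (rule decseq_SucI) (use Suc_leD in \<open>unfold visits_def, blast\<close>)
  \<comment> \<open>Raising the time bound by one is taking a preimage, which preserves
    measure.\<close>
  have const: "measure \<mu> (visits T Q m) = measure \<mu> (visits T Q 0)" for m
  proof (induction m)
    case (Suc m)
    have "measure \<mu> (preimage T (visits T Q m)) = measure \<mu> (visits T Q m)"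
      using T borel by (simp add: measure_preserving_def)
    then show ?case using Suc by (simp add: preimage_visits[OF ran])
  qed simp
  let ?E = "\<Inter>m. visits T Q m"
  have "preimage T ?E = (\<Inter>m. preimage T (visits T Q m))" by (rule preimage_INT)
  also have "\<dots> = (\<Inter>m. visits T Q (Suc m))" by (simp add: preimage_visits[OF ran])
  \<comment> \<open>Dropping the first term of a decreasing sequence does not change its
    intersection.\<close>
  also have "\<dots> = ?E" using dec by (auto simp: decseq_Suc_iff)
  finally have inv: "preimage T ?E = ?E" .
  have "(\<lambda>m. measure \<mu> (visits T Q m)) \<longlonglongrightarrow> measure \<mu> ?E"
    using borel dec by (intro finite_Lim_measure_decseq) (auto simp: sets)
  then have E: "measure \<mu> ?E = measure \<mu> (visits T Q 0)"
    unfolding ext[of "\<lambda>m. measure \<mu> (visits T Q m)" "\<lambda>_. measure \<mu> (visits T Q 0)", OF const]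
    by (simp add: LIMSEQ_const_iff)
  have dom: "dom T \<in> sets borel" "measure \<mu> (dom T) = 1"
  proof -
    have "preimage T UNIV = dom T" by (auto simp: preimage_def)
    moreover have "space \<mu> = UNIV" using sets_eq_imp_space_eq[OF sets] by simp
    ultimately show "dom T \<in> sets borel" "measure \<mu> (dom T) = 1"
      using T prob_space by (auto simp: measure_preserving_def dest!: bspec[of _ _ UNIV])
  qed
  \<comment> \<open>Visits at time 0 already cover \<open>Q\<close> up to a null set, so
    \<open>?E\<close> has positive measure and ergodicity raises it to 1.\<close>
  have "Q \<inter> dom T \<subseteq> visits T Q 0" by (force simp: visits_def intro: exI[of _ 0])
  then have "measure \<mu> (Q \<inter> dom T) \<le> measure \<mu> (visits T Q 0)"
    by (intro finite_measure_mono) (simp_all add: sets borel)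
  moreover have "measure \<mu> (Q \<inter> dom T) = measure \<mu> Q"
    using measure_space_inter[of Q "dom T"] Q dom prob_space by (simp add: sets)
  ultimately have "measure \<mu> ?E > 0" using E Q(2) by simp
  moreover have "?E \<in> sets borel" using borel by (intro sets.countable_INT) auto
  ultimately have "measure \<mu> ?E = 1" using erg inv by (auto simp: ergodic_def)
  then show ?thesis using E const[of m] by simp
qed

text \<open>The preimage of a union of balls is the union of their preimages, which have oracle-free
  indices; so pulling back acts on indices by one recursive \<open>g\<close> for each oracle
  \<open>B\<close>, and iterating \<open>T\<close> iterates \<open>g\<close>.\<close>

lemma iterate_pulls_back_Sigma_1:
  assumes "computable_map s T" "ran T \<subseteq> dom T"
  obtains g where "recursive_in {} g"
    "\<And>x k e. x \<in> dom T \<Longrightarrow>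
      \<exists>y. iterate T k x = Some y \<and> (y \<in> Sigma_set s B 1 e \<longleftrightarrow> x \<in> Sigma_set s B 1 ((g ^^ k) e))"
proof -
  obtain f where "computable f" and f: "\<And>i. preimage T (ideal_ball s i) = dom T \<inter> Sigma_set s {} 1 (f i)"
    using assms(1) unfolding computable_map_def uniformly_def by blast
  then have "recursive_in B f" using recursive_in_computable by blast
  note f_comp = recursive_in_comp[OF this]
  have "ce_in B (\<lambda>z. \<exists>i. i \<in> ce B (pi1 z) \<and> pi2 z \<in> ce {} (f i))"
    by (intro ce_intros ce_in_ce_empty rec_intros f_comp)
  then obtain g where g: "recursive_in {} g" "\<And>e. ce B (g e) = {j. \<exists>i. i \<in> ce B e \<and> j \<in> ce {} (f i)}"
    by (rule ce_in_uniform_index) blast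
  have one: "y \<in> Sigma_set s B 1 e \<longleftrightarrow> x \<in> Sigma_set s B 1 (g e)" if "T x = Some y" for x y e
  proof -
    have "y \<in> ideal_ball s i \<longleftrightarrow> x \<in> Sigma_set s {} 1 (f i)" for i
    proof -
      have "y \<in> ideal_ball s i \<longleftrightarrow> x \<in> preimage T (ideal_ball s i)" using that by (simp add: preimage_def)
      also have "\<dots> \<longleftrightarrow> x \<in> Sigma_set s {} 1 (f i)" unfolding f using that by (simp add: domI)
      finally show ?thesis .
    qed
    then show ?thesis by (auto simp: g(2))
  qed
  \<comment> \<open>Membership of \<open>y\<close> in \<open>dom T\<close> lets the orbit continue;
    \<open>e\<close> varies because the last step of the orbit replaces \<open>e\<close> by
    \<open>g e\<close>.\<close>
  have "\<exists>y\<in>dom T. iterate T k x = Some y \<and> (y \<in> Sigma_set s B 1 e \<longleftrightarrow> x \<in> Sigma_set s B 1 ((g ^^ k) e))"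
    if "x \<in> dom T" for x k e
    using that
  proof (induction k arbitrary: e)
    case (Suc k)
    obtain y where y: "y \<in> dom T" "iterate T k x = Some y"
      "y \<in> Sigma_set s B 1 (g e) \<longleftrightarrow> x \<in> Sigma_set s B 1 ((g ^^ k) (g e))"
      using Suc.IH[OF Suc.prems, of "g e"] by blast
    obtain z where z: "T y = Some z" using y(1) by blast
    then have "z \<in> dom T" using assms(2) by (auto simp: ran_def)
    moreover have "iterate T (Suc k) x = Some z" using y(2) z by (simp add: iterate_Suc)
    moreover have "z \<in> Sigma_set s B 1 e \<longleftrightarrow> x \<in> Sigma_set s B 1 ((g ^^ Suc k) e)"
      using one[OF z, of e] y(3) by (simp add: funpow_swap1)
    ultimately show ?case by blast
  qed simp
  with g(1) that show thesis by blast
qed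

lemma Sigma_set_1_borel: "Sigma_set s A 1 e \<in> sets borel"
  by (simp add: open_ideal_ball borel_open open_UN)

section \<open>Visits to \<open>P\<close> from genericity and recurrence\<close>

theorem theorem3p30:
  fixes s :: "nat \<Rightarrow> 'a::polish_space" and \<mu> :: "'a measure"
    and n :: nat and A :: "nat set" and x :: 'a
    and P :: "'a set" and T :: "'a \<rightharpoonup> 'a"
  assumes "computable_prob_space s \<mu>"
    and "n \<ge> 1"
    and "weakly_Pi_generic s \<mu> n A x"
    and "is_Pi s A n P" and "x \<in> P" and "measure \<mu> P > 0"
    and "measure_preserving \<mu> T" and "computable_map s T" and "ergodic \<mu> T"
    and "x \<in> dom T"
  shows "\<exists>k>0. \<exists>y\<in>P. iterate T k x = Some y"
proof -
  have s: "computable_metric_space s" and "prob_space \<mu>" and sets: "sets \<mu> = sets borel"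
    using assms(1) by (auto simp: computable_prob_space_def)
  interpret prob_space \<mu> by fact
  have space: "space \<mu> = UNIV" using sets_eq_imp_space_eq[OF sets] by simp
  have ran: "ran T \<subseteq> dom T" using assms(7) by (simp add: measure_preserving_def)
  \<comment> \<open>\<open>visits T Q 1\<close>, the points with a visit at a positive time, has
    measure 1, and \<open>N\<close> lies in its complement.\<close>
  have null: "measure \<mu> N = 0" if Q: "Q \<in> sets borel" "measure \<mu> Q > 0" and N: "N \<inter> visits T Q 1 = {}" for Q N
  proof -
    have W: "visits T Q 1 \<in> sets \<mu>" unfolding sets by (rule visits_borel[OF assms(7) Q(1)])
    have "measure \<mu> N \<le> measure \<mu> (space \<mu> - visits T Q 1)"
      using N W by (intro finite_measure_mono sets.compl_sets) (auto simp: space)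
    also have "\<dots> = 0"
      using prob_compl[OF W] measure_visits[OF \<open>prob_space \<mu>\<close> sets assms(7,9) Q, of 1] by simp
    finally show ?thesis by (simp add: measure_le_0_iff)
  qed
  have visit: "\<exists>k>0. \<exists>y\<in>P. iterate T k x = Some y" if "x \<in> visits T Q 1" "Q \<subseteq> P" for Q
    using that by (force simp: visits_def Suc_le_eq)
  show ?thesis
  proof (cases "n = 1")
    case True
    obtain U where U: "is_Sigma s {} 1 U" "U \<subseteq> P" "measure \<mu> U > 0"
      using assms(3-5) True unfolding weakly_Pi_generic_def by auto
    then obtain e where e: "U = Sigma_set s {} 1 e" by (auto simp: is_Sigma_def)
    obtain g where g: "recursive_in {} g" "\<And>x k e. x \<in> dom T \<Longrightarrow>
      \<exists>y. iterate T k x = Some y \<and> (y \<in> Sigma_set s {} 1 e \<longleftrightarrow> x \<in> Sigma_set s {} 1 ((g ^^ k) e))"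
      using iterate_pulls_back_Sigma_1[OF assms(8) ran] by blast
    \<comment> \<open>The balls of all pullbacks of \<open>U\<close>, with \<open>Suc k\<close>
      since times are positive. They are enumerated relative to \<open>A\<close> so that
      \<open>- ?V\<close> is a Pi^0_1(A) set, to which genericity applies.\<close>
    have "ce_in A (\<lambda>b. \<exists>k. b \<in> ce {} ((g ^^ Suc k) e))"
      by (intro ce_intros ce_in_ce_empty rec_intros recursive_in_empty[OF g(1)])
    then obtain e' where e': "ce A e' = {b. \<exists>k. b \<in> ce {} ((g ^^ Suc k) e)}" by (rule ce_in_index)
    let ?V = "Sigma_set s A 1 e'"
    have V: "z \<in> ?V \<longleftrightarrow> (\<exists>k. z \<in> Sigma_set s {} 1 ((g ^^ Suc k) e))" for z
      unfolding One_nat_def Sigma_set.simps e' by blast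
    have W: "z \<in> visits T U 1 \<longleftrightarrow> z \<in> ?V" if z: "z \<in> dom T" for z
    proof -
      have "z \<in> visits T U 1 \<longleftrightarrow> (\<exists>k. \<exists>y\<in>U. iterate T (Suc k) z = Some y)"
        using visits_Suc_0_iff[OF z] by simp
      also have "\<dots> \<longleftrightarrow> (\<exists>k. z \<in> Sigma_set s {} 1 ((g ^^ Suc k) e))"
      proof (rule ex_cong1)
        fix k
        obtain y where "iterate T (Suc k) z = Some y"
          "y \<in> Sigma_set s {} 1 e \<longleftrightarrow> z \<in> Sigma_set s {} 1 ((g ^^ Suc k) e)"
          using g(2)[OF z] by blast
        then show "(\<exists>y\<in>U. iterate T (Suc k) z = Some y) \<longleftrightarrow> z \<in> Sigma_set s {} 1 ((g ^^ Suc k) e)"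
          unfolding e by auto
      qed
      finally show ?thesis by (simp only: V)
    qed
    have "x \<in> ?V"
    proof (rule ccontr)
      assume "x \<notin> ?V"
      moreover have "is_Pi s A 1 (- ?V)" by (auto simp: is_Pi_def is_Sigma_def)
      ultimately obtain N where N: "N \<subseteq> - ?V" "measure \<mu> N > 0"
        using assms(3) True unfolding weakly_Pi_generic_def by auto
      have "N \<inter> visits T U 1 = {}" using N(1) W visits_subset_dom[of T] by blast
      from null[OF _ U(3) this] N(2) show False using Sigma_set_1_borel e by auto
    qed
    then show ?thesis using visit[OF _ U(2)] W assms(10) by blast
  next
    case False
    \<comment> \<open>The shape needed by \<open>is_Sigma_iterated_jump\<close>; the subtraction is
      exact because \<open>n \<ge> 2\<close>.\<close>
    with assms(2) have n: "n = Suc 1 + (n - 2)" by simp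
    let ?B = "(jump ^^ (n - 2)) A"
    obtain Q where Q: "is_Pi s ?B 1 Q" "Q \<subseteq> P" "measure \<mu> Q > 0"
      using assms(3-5) False unfolding weakly_Pi_generic_def by auto
    then obtain e where e: "- Q = Sigma_set s ?B 1 e" by (auto simp: is_Pi_def is_Sigma_def)
    obtain g where g: "recursive_in {} g" "\<And>x k e. x \<in> dom T \<Longrightarrow>
      \<exists>y. iterate T k x = Some y \<and> (y \<in> Sigma_set s ?B 1 e \<longleftrightarrow> x \<in> Sigma_set s ?B 1 ((g ^^ k) e))"
      using iterate_pulls_back_Sigma_1[OF assms(8) ran] by blast
    \<comment> \<open>The index \<open>e\<close> belongs to \<open>- Q\<close>, so the enumerated
      numbers are indices of its pullbacks. The union of their complements, which is
      \<open>?V\<close>, is thus Sigma^0_2 in \<open>?B\<close>.\<close>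
    have "ce_in ?B (\<lambda>b. \<exists>k. b = (g ^^ Suc k) e)"
      by (intro ce_intros ce_in_decidable rec_intros recursive_in_empty[OF g(1)])
    then obtain e' where e': "ce ?B e' = {b. \<exists>k. b = (g ^^ Suc k) e}" by (rule ce_in_index)
    let ?V = "Sigma_set s ?B (Suc 1) e'"
    have V: "z \<in> ?V \<longleftrightarrow> (\<exists>k. z \<notin> Sigma_set s ?B 1 ((g ^^ Suc k) e))" for z
      unfolding One_nat_def Sigma_set.simps e' by blast
    have W: "z \<in> visits T Q 1 \<longleftrightarrow> z \<in> ?V" if z: "z \<in> dom T" for z
    proof -
      have "z \<in> visits T Q 1 \<longleftrightarrow> (\<exists>k. \<exists>y\<in>Q. iterate T (Suc k) z = Some y)"
        using visits_Suc_0_iff[OF z] by simp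
      also have "\<dots> \<longleftrightarrow> (\<exists>k. z \<notin> Sigma_set s ?B 1 ((g ^^ Suc k) e))"
      proof (rule ex_cong1)
        fix k
        obtain y where y: "iterate T (Suc k) z = Some y"
          "y \<in> Sigma_set s ?B 1 e \<longleftrightarrow> z \<in> Sigma_set s ?B 1 ((g ^^ Suc k) e)"
          using g(2)[OF z] by blast
        show "(\<exists>y\<in>Q. iterate T (Suc k) z = Some y) \<longleftrightarrow> z \<notin> Sigma_set s ?B 1 ((g ^^ Suc k) e)"
          unfolding y(2)[symmetric] e[symmetric] using y(1) by simp
      qed
      finally show ?thesis by (simp only: V)
    qed
    have "x \<in> ?V"
    proof (rule ccontr)
      assume "x \<notin> ?V"
      \<comment> \<open>The \<open>n - 2\<close> jumps in \<open>?B\<close> turn into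
        \<open>n - 2\<close> further levels above the second.\<close>
      moreover have "is_Pi s A n (- ?V)"
      proof -
        have "is_Sigma s ?B (Suc 1) ?V" unfolding is_Sigma_def by blast
        then have "is_Sigma s A (Suc 1 + (n - 2)) ?V" by (rule is_Sigma_iterated_jump[OF s])
        then show ?thesis unfolding is_Pi_def by (simp only: n[symmetric] double_complement)
      qed
      ultimately obtain N where N: "N \<subseteq> - ?V" "measure \<mu> N > 0"
        using assms(3) False unfolding weakly_Pi_generic_def by (metis ComplI)
      have "N \<inter> visits T Q 1 = {}" using N(1) W visits_subset_dom[of T] by blast
      moreover have "Q \<in> sets borel"
        using borel_comp[OF Sigma_set_1_borel[of s ?B e]] by (simp only: e[symmetric] double_complement)
      ultimately show False using null[OF _ Q(3)] N(2) by auto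
    qed
    then show ?thesis using visit[OF _ Q(2)] W assms(10) by blast
  qed
qed

end
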